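(* Let $K\geq 3$, let $D=\{d_1,\ldots,d_K\}$ be a set with $K$ elements, and let $\mathbf{X}_{[1,\infty)}=\{X_n:n\geq 1\}$ be an infinite exchangeable sequence of $D$-valued random variables such that $\mathbb{P}(\mathbf{X}_{[n]}=\mathbf{x}_n)>0$ for all $n\geq 1$ and all $\mathbf{x}_n\in D^n$. Then $\mathbf{X}_{[1,\infty)}$ is Hoeffding decomposable if and only if, for every $n\geq 2$, every $u=2,\ldots,n$, every $\mathbf{z}_K=(z_1,\ldots,z_K)\in\mathcal{N}(n-1,K)$ and every $\mathbf{m}_{K-2}=(m_1,\ldots,m_{K-2})\in\bigcup_{a=0}^{n}\mathcal{N}(a,K-2)$, the following quantity equals $0$: $$\sum_{(\ast)}(-1)^{k_1}\binom{n-u}{k_1,k_2,\ldots,k_{K-1}}\sum_{(\ast\ast)}(-1)^{q_1}\binom{u}{q_1,\ldots,q_{K-1}}\binom{k_1+q_1}{m_1-k_2-q_2,\ldots,m_{K-2}-k_{K-1}-q_{K-1}}_{\ast}\,\mathbb{P}^{n}_{n+u-1}\big(z_1+q_1,\ldots,z_{K-1}+q_{K-1}\,\big|\,k_1+q_1,\ldots,k_{K-1}+q_{K-1}\big),$$ where the sum $(\ast)$ is extended to all $(n-1,n-u,\mathbf{z}_K)$-coherent vectors $(k_1,\ldots,k_{K-1})$, and the sum $(\ast\ast)$ is extended to all $\mathbf{q}_{K-1}=(q_1,\ldots,q_{K-1})\in\bigcup_{a=0}^{u}\mathcal{N}(a,K-1)$.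
   Context: **Notation.** $\mathbf{X}_{[n]}=(X_1,\ldots,X_n)$ and $\mathbf{X}_{[u,n]}=(X_u,\ldots,X_n)$. A sequence is exchangeable if, for every $n\ge 2$, the law of $\mathbf{X}_{[n]}$ is invariant under all permutations of its coordinates. $\mathcal{N}(n,K)$ is the set of weak $K$-compositions of $n$: all $(i_1,\ldots,i_K)\in\mathbb{N}^K$ (with $0\in\mathbb{N}$) such that $\sum_{j=1}^K i_j=n$. For integers $m\geq 1$ (or $m=0$) and $b_1,\ldots,b_k\geq 0$ with $\sum b_i\leq m$, $$\binom{m}{b_1,\ldots,b_k}=\frac{m!}{b_1!\cdots b_k!\,(m-\sum b_i)!}.$$ For integers $a,b$, $\binom{a}{b}_{\ast}=\binom{a}{b}\mathbf{1}_{\{0,\ldots,a\}}(b)$ (so it is $0$ unless $0\leq b\leq a$), and for integers $m,b_1,\ldots,b_k$, $$\binom{m}{b_1,\ldots,b_k}_{\ast}=\binom{m}{b_1}_{\ast}\binom{m-b_1}{b_2}_{\ast}\cdots\binom{m-(b_1+\cdots+b_{k-1})}{b_k}_{\ast}.$$ **Coherent vectors.** For $\mathbf{z}_K=(z_1,\ldots,z_K)\in\mathcal{N}(n-1,K)$ and $2\leq u\leq n$, the $(n-1,n-u,\mathbf{z}_K)$-coherent vectors are the integer vectors $(k_1,\ldots,k_{K-1})$ such that, for $j=1,\ldots,K-1$, $$k_j\in\Big\{0\vee\Big[z_j-(u-1)-\sum_{p=1}^{j-1}(z_p-k_p)\Big],\ldots,z_j\wedge\Big(n-u-\sum_{p=1}^{j-1}k_p\Big)\Big\},$$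 where $\vee,\wedge$ denote maximum and minimum. **Conditional probabilities.** $\mathbb{P}^{n}_{n+u-1}(a_1,\ldots,a_{K-1}\mid b_1,\ldots,b_{K-1})$ denotes the conditional probability that the vector $\mathbf{X}_{[n+u-1]}$ contains exactly $a_p$ coordinates equal to $d_p$, $p=1,\ldots,K-1$, given that the subvector $\mathbf{X}_{[n]}$ contains exactly $b_p$ coordinates equal to $d_p$, $p=1,\ldots,K-1$. **Hoeffding decomposability.** Let $L_s(\mathbf{X}_{[n]})$ be the Hilbert space of all real random variables $T(\mathbf{X}_{[n]})$ with $T:D^n\to\mathbb{R}$ symmetric, with inner product $\langle T_1,T_2\rangle=\mathbb{E}(T_1(\mathbf{X}_{[n]})T_2(\mathbf{X}_{[n]}))$. Let $SU_0(\mathbf{X}_{[n]})=\mathbb{R}$ and, for $k=1,\ldots,n$, let $SU_k(\mathbf{X}_{[n]})$ be the set of all random variables of the form $$F(\mathbf{X}_{[n]})=\sum_{1\leq j_1<\cdots<j_k\leq n}\varphi(X_{j_1},\ldots,X_{j_k}),$$ with $\varphi:D^k\to\mathbb{R}$ symmetric (the kernel of $F$). These spaces increase with $k$ and $SU_n(\mathbf{X}_{[n]})=L_s(\mathbf{X}_{[n]})$. Set $SH_0(\mathbf{X}_{[n]})=\mathbb{R}$ and $SH_k(\mathbf{X}_{[n]})=SU_k(\mathbf{X}_{[n]})\cap SU_{k-1}(\mathbf{X}_{[n]})^{\perp}$ for $k=1,\ldots,n$, with orthogonals taken in $L_s(\mathbf{X}_{[n]})$. The exchangeable sequence $\mathbf{X}_{[1,\infty)}$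 is Hoeffding decomposable if for all $n\geq 2$ and all $k=1,\ldots,n$ the following equivalence holds: a random variable $F_k=\sum_{1\leq i_1<\cdots<i_k\leq n}\varphi_k(X_{i_1},\ldots,X_{i_k})$, with $\varphi_k:D^k\to\mathbb{R}$ symmetric, belongs to $SH_k(\mathbf{X}_{[n]})$ if and only if $\varphi_k$ is completely degenerate, i.e. $\mathbb{E}(\varphi_k(\mathbf{X}_{[k]})\mid\mathbf{X}_{[2,k]})=0$ almost surely (for $k=1$ this means $\mathbb{E}(\varphi_1(X_1))=0$). *)

theory Defs
  imports "HOL-Probability.Probability" "HOL-Combinatorics.Permutations"
begin

section \<open>Compositions, multinomial coefficients, coherent vectors\<close>

text \<open>Vectors \<open>(v\<^sub>1, \<dots>, v\<^sub>r)\<close> are functions on \<open>{1..r}\<close> that are extensional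
  (\<open>undefined\<close> elsewhere), so that sets of vectors have the right cardinality
  and sums over them count every vector once.\<close>

definition weak_compositions :: "nat \<Rightarrow> nat \<Rightarrow> (nat \<Rightarrow> nat) set" where
  "weak_compositions n r = {v \<in> {1..r} \<rightarrow>\<^sub>E UNIV. (\<Sum>j=1..r. v j) = n}"

text \<open>The multinomial coefficient with implicit last entry \<open>m - (b\<^sub>1 + \<dots> + b\<^sub>r)\<close>;
  only meaningful if \<open>b\<^sub>1 + \<dots> + b\<^sub>r \<le> m\<close>.\<close>

definition multinom :: "nat \<Rightarrow> nat \<Rightarrow> (nat \<Rightarrow> nat) \<Rightarrow> real" where
  "multinom m r b = fact m / ((\<Prod>i=1..r. fact (b i)) * fact (m - (\<Sum>i=1..r. b i)))"

definition binom_star :: "int \<Rightarrow> int \<Rightarrow> real" where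
  "binom_star a b = (if 0 \<le> b \<and> b \<le> a then real (nat a choose nat b) else 0)"

definition multinom_star :: "int \<Rightarrow> nat \<Rightarrow> (nat \<Rightarrow> int) \<Rightarrow> real" where
  "multinom_star m r b = (\<Prod>j=1..r. binom_star (m - (\<Sum>p=1..<j. b p)) (b j))"

text \<open>The \<open>(n-1, n-u, z)\<close>-coherent vectors for \<open>z = (z\<^sub>1, \<dots>, z\<^sub>K)\<close>. The lower bound is
  at least 0, so the entries can be taken in \<^typ>\<open>nat\<close>; the bounds themselves
  are computed in \<^typ>\<open>int\<close> to avoid truncated subtraction.\<close>

definition coherent_vectors :: "nat \<Rightarrow> nat \<Rightarrow> nat \<Rightarrow> (nat \<Rightarrow> nat) \<Rightarrow> (nat \<Rightarrow> nat) set" where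
  "coherent_vectors K n u z = {k \<in> {1..K-1} \<rightarrow>\<^sub>E UNIV. \<forall>j\<in>{1..K-1}.
     int (k j) \<in> {max 0 (int (z j) - (int u - 1) - (\<Sum>p=1..<j. int (z p) - int (k p)))
                 .. min (int (z j)) (int n - int u - (\<Sum>p=1..<j. int (k p)))}}"

section \<open>Exchangeable sequences\<close>

text \<open>Sequences \<open>X\<close> are indexed by \<^typ>\<open>nat\<close>, but only the entries \<open>X i\<close> with \<open>i \<ge> 1\<close> matter.\<close>

definition exchangeable :: "'w measure \<Rightarrow> 'a measure \<Rightarrow> (nat \<Rightarrow> 'w \<Rightarrow> 'a) \<Rightarrow> bool" where
  "exchangeable M N X \<longleftrightarrow> (\<forall>n\<ge>2. \<forall>\<pi>. \<pi> permutes {1..n} \<longrightarrow>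
     distr M (\<Pi>\<^sub>M i\<in>{1..n}. N) (\<lambda>\<omega>. \<lambda>i\<in>{1..n}. X (\<pi> i) \<omega>)
       = distr M (\<Pi>\<^sub>M i\<in>{1..n}. N) (\<lambda>\<omega>. \<lambda>i\<in>{1..n}. X i \<omega>))"

definition has_counts :: "nat \<Rightarrow> (nat \<Rightarrow> 'a) \<Rightarrow> (nat \<Rightarrow> 'w \<Rightarrow> 'a) \<Rightarrow> nat \<Rightarrow> (nat \<Rightarrow> nat) \<Rightarrow> 'w \<Rightarrow> bool" where
  "has_counts r d X n a \<omega> \<longleftrightarrow> (\<forall>p\<in>{1..r}. card {i \<in> {1..n}. X i \<omega> = d p} = a p)"

text \<open>\<open>count_cond_prob M K d X n N a b\<close> is
  \<open>\<bbbP>\<^sup>n\<^sub>N(a\<^sub>1, \<dots>, a\<^bsub>K-1\<^esub> | b\<^sub>1, \<dots>, b\<^bsub>K-1\<^esub>)\<close>.\<close>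

definition count_cond_prob ::
  "'w measure \<Rightarrow> nat \<Rightarrow> (nat \<Rightarrow> 'a) \<Rightarrow> (nat \<Rightarrow> 'w \<Rightarrow> 'a) \<Rightarrow> nat \<Rightarrow> nat \<Rightarrow> (nat \<Rightarrow> nat) \<Rightarrow> (nat \<Rightarrow> nat) \<Rightarrow> real" where
  "count_cond_prob M K d X n N a b =
     \<P>(\<omega> in M. has_counts (K-1) d X N a \<omega> \<bar> has_counts (K-1) d X n b \<omega>)"

section \<open>Hoeffding decomposability\<close>

text \<open>Kernels \<open>D\<^sup>k \<rightarrow> \<real>\<close> are functions on lists, of which only the values on
  lists of length \<open>k\<close> with entries in \<open>D\<close> matter.\<close>

definition symmetric_kernel :: "'a set \<Rightarrow> nat \<Rightarrow> ('a list \<Rightarrow> real) \<Rightarrow> bool" where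
  "symmetric_kernel D k \<phi> \<longleftrightarrow> (\<forall>xs ys. length xs = k \<longrightarrow> set xs \<subseteq> D \<longrightarrow> mset xs = mset ys \<longrightarrow> \<phi> xs = \<phi> ys)"

text \<open>The subvector of \<open>X\<close> with indices in the finite set \<open>J\<close>, in increasing order.\<close>

definition subvec :: "(nat \<Rightarrow> 'w \<Rightarrow> 'a) \<Rightarrow> nat set \<Rightarrow> 'w \<Rightarrow> 'a list" where
  "subvec X J \<omega> = map (\<lambda>j. X j \<omega>) (sorted_list_of_set J)"

text \<open>A family of indices \<open>1 \<le> j\<^sub>1 < \<dots> < j\<^sub>k \<le> n\<close> is represented by the set of its members.\<close>

definition U_stat :: "(nat \<Rightarrow> 'w \<Rightarrow> 'a) \<Rightarrow> nat \<Rightarrow> nat \<Rightarrow> ('a list \<Rightarrow> real) \<Rightarrow> 'w \<Rightarrow> real" where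
  "U_stat X n k \<phi> \<omega> = (\<Sum>J | J \<subseteq> {1..n} \<and> card J = k. \<phi> (subvec X J \<omega>))"

text \<open>Random variables are actual functions on the sample space rather than classes modulo
  null sets. This makes no difference for the definitions below, since \<open>D\<close> is finite,
  every value of \<open>X\<^bsub>[n]\<^esub>\<close> has positive probability in the intended setting, and
  orthogonality does not depend on the representative.\<close>

definition Ls :: "'a set \<Rightarrow> (nat \<Rightarrow> 'w \<Rightarrow> 'a) \<Rightarrow> nat \<Rightarrow> ('w \<Rightarrow> real) set" where
  "Ls D X n = {\<lambda>\<omega>. T (subvec X {1..n} \<omega>) |T. symmetric_kernel D n T}"

definition SU :: "'a set \<Rightarrow> (nat \<Rightarrow> 'w \<Rightarrow> 'a) \<Rightarrow> nat \<Rightarrow> nat \<Rightarrow> ('w \<Rightarrow> real) set" where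
  "SU D X n k = (if k = 0 then {\<lambda>\<omega>. c |c. True}
                 else {U_stat X n k \<phi> |\<phi>. symmetric_kernel D k \<phi>})"

definition Ls_orthogonal ::
  "'w measure \<Rightarrow> 'a set \<Rightarrow> (nat \<Rightarrow> 'w \<Rightarrow> 'a) \<Rightarrow> nat \<Rightarrow> ('w \<Rightarrow> real) set \<Rightarrow> ('w \<Rightarrow> real) set" where
  "Ls_orthogonal M D X n S = {F \<in> Ls D X n. \<forall>G\<in>S. (\<integral>\<omega>. F \<omega> * G \<omega> \<partial>M) = 0}"

definition SH :: "'w measure \<Rightarrow> 'a set \<Rightarrow> (nat \<Rightarrow> 'w \<Rightarrow> 'a) \<Rightarrow> nat \<Rightarrow> nat \<Rightarrow> ('w \<Rightarrow> real) set" where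
  "SH M D X n k = (if k = 0 then {\<lambda>\<omega>. c |c. True}
                   else SU D X n k \<inter> Ls_orthogonal M D X n (SU D X n (k-1)))"

definition sigma_gen :: "'w measure \<Rightarrow> 'a set \<Rightarrow> (nat \<Rightarrow> 'w \<Rightarrow> 'a) \<Rightarrow> nat set \<Rightarrow> 'w measure" where
  "sigma_gen M D X J =
     vimage_algebra (space M) (\<lambda>\<omega>. \<lambda>i\<in>J. X i \<omega>) (\<Pi>\<^sub>M i\<in>J. count_space D)"

definition completely_degenerate ::
  "'w measure \<Rightarrow> 'a set \<Rightarrow> (nat \<Rightarrow> 'w \<Rightarrow> 'a) \<Rightarrow> nat \<Rightarrow> ('a list \<Rightarrow> real) \<Rightarrow> bool" where
  "completely_degenerate M D X k \<phi> \<longleftrightarrow>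
     (if k = 1 then (\<integral>\<omega>. \<phi> (subvec X {1..1} \<omega>) \<partial>M) = 0
      else (AE \<omega> in M. real_cond_exp M (sigma_gen M D X {2..k}) (\<lambda>\<omega>. \<phi> (subvec X {1..k} \<omega>)) \<omega> = 0))"

definition hoeffding_decomposable :: "'w measure \<Rightarrow> 'a set \<Rightarrow> (nat \<Rightarrow> 'w \<Rightarrow> 'a) \<Rightarrow> bool" where
  "hoeffding_decomposable M D X \<longleftrightarrow>
     (\<forall>n\<ge>2. \<forall>k\<in>{1..n}. \<forall>\<phi>. symmetric_kernel D k \<phi> \<longrightarrow>
        (U_stat X n k \<phi> \<in> SH M D X n k \<longleftrightarrow> completely_degenerate M D X k \<phi>))"

end

(*
  Since every word has positive probability, everything reduces to finite sums over words weighted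
  by their law.  For symmetric phi of order k and psi of order k - 1, the expectation of
  phi(X_J) psi(X_I) depends only on the overlap of J and I, by exchangeability.  Complete degeneracy
  of phi means that these expectations vanish for overlap k - 1, and orthogonality of the U-statistics
  of phi and psi in n variables is the vanishing of their sum over all pairs (J, I).  Taking
  n = k + u - 1 and inducting on u shows that Hoeffding decomposability forces them to vanish for every
  overlap k - u ("weak independence").  Conversely, given weak independence, write
  phi = phi' + raise c with phi' degenerate: U-statistics of phi' are orthogonal to those of lower
  order, so orthogonality for phi kills the U-statistic of c, hence c by injectivity.

  Multiplied by the law, degenerate kernels become the symmetric tensors in the n-th power of the
  sum-zero hyperplane of R^K, and an explicit basis of these, paired with the indicators of the
  counts z, turns weak independence into the displayed sums.
*)

theory Submission
  imports Defs "HOL-Combinatorics.Multiset_Permutations"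
begin

section \<open>Words over the state space and their law\<close>

text \<open>Symmetric kernels are treated as functions of multisets, and \<open>raise\<close>
  carries the linear algebra. The U-statistic of \<open>raise \<phi>\<close> is a multiple of that
  of \<open>\<phi>\<close>, nonzero below full order; at full order a U-statistic is mere
  evaluation, whence the injectivity. Under the law, raising is adjoint, up to the factor
  \<open>k\<close>, to the conditional sum whose vanishing is degeneracy, so degenerate kernels are
  the orthogonal complement of the range of \<open>raise\<close>.

  The letter \<open>d 1\<close> is special in the displayed sums because of the chosen basis: zero
  letter sums recover a tensor from its values on words avoiding \<open>d 1\<close>, each
  \<open>d 1\<close> costing a sign. This produces the powers of -1 and leaves \<open>K - 2\<close>
  parameters \<open>m\<close>. Degenerate kernels are these tensors divided by the law; the division
  turns the sum over the letters that \<open>\<phi>\<close> does not read into a conditional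
  probability.\<close>

definition words :: "'a set \<Rightarrow> nat \<Rightarrow> 'a list set" where
  "words D n = {xs. set xs \<subseteq> D \<and> length xs = n}"

lemma finite_words [simp]: "finite D \<Longrightarrow> finite (words D n)"
  unfolding words_def by (rule finite_lists_length_eq)

lemma words_0 [simp]: "words D 0 = {[]}"
  by (auto simp: words_def)

lemma sum_words_append:
  fixes f :: "'a list \<Rightarrow> 'b::comm_monoid_add"
  shows "(\<Sum>xs\<in>words D (m + n). f xs) = (\<Sum>xs\<in>words D m. \<Sum>ys\<in>words D n. f (xs @ ys))"
proof -
  have "(\<Sum>xs\<in>words D m. \<Sum>ys\<in>words D n. f (xs @ ys))
      = (\<Sum>(xs, ys)\<in>words D m \<times> words D n. f (xs @ ys))"
    by (rule sum.cartesian_product)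
  also have "\<dots> = (\<Sum>xs\<in>words D (m + n). f xs)"
    by (rule sum.reindex_bij_witness[where j = "\<lambda>(xs, ys). xs @ ys" and i = "\<lambda>xs. (take m xs, drop m xs)"])
       (auto simp: words_def dest: in_set_takeD in_set_dropD)
  finally show ?thesis by simp
qed

lemma sum_words_Suc:
  fixes f :: "'a list \<Rightarrow> 'b::comm_monoid_add"
  shows "(\<Sum>xs\<in>words D (Suc n). f xs) = (\<Sum>xs\<in>words D n. \<Sum>x\<in>D. f (x # xs))"
proof -
  have "(\<Sum>xs\<in>words D n. \<Sum>x\<in>D. f (x # xs)) = (\<Sum>(xs, x)\<in>words D n \<times> D. f (x # xs))"
    by (rule sum.cartesian_product)
  also have "\<dots> = (\<Sum>xs\<in>words D (Suc n). f xs)"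
    by (rule sum.reindex_bij_witness[where j = "\<lambda>(xs, x). x # xs" and i = "\<lambda>xs. (tl xs, hd xs)"])
       (auto simp: words_def length_Suc_conv)
  finally show ?thesis by simp
qed

text \<open>Exchangeability is stated for permutations of a whole block \<open>{1..N}\<close>.
  Prescribing the images of an initial segment leaves two complements of equal cardinality, and any
  bijection between them completes the permutation.\<close>

lemma permutation_extending_list:
  assumes "distinct js" "set js \<subseteq> {1..N}"
  obtains \<pi> where "\<pi> permutes {1..N}" "map \<pi> [1..<Suc (length js)] = js"
proof -
  let ?n = "length js"
  have nN: "?n \<le> N"
    using assms by (metis card_atLeastAtMost card_mono diff_Suc_1 distinct_card finite_atLeastAtMost)
  define f where "f i = js ! (i - 1)" for i
  have f: "bij_betw f {1..?n} (set js)"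
  proof -
    have "bij_betw ((!) js) {..<?n} (set js)" by (rule bij_betw_nth) (use assms in auto)
    moreover have "bij_betw (\<lambda>i. i - 1) {1..?n} {..<?n}"
      by (rule bij_betw_byWitness[where f' = Suc]) auto
    ultimately show ?thesis unfolding f_def using bij_betw_trans by (fastforce simp: o_def)
  qed
  have "card ({1..N} - {1..?n}) = card ({1..N} - set js)"
    using assms nN by (subst (1 2) card_Diff_subset) (auto simp: distinct_card)
  then obtain g where g: "bij_betw g ({1..N} - {1..?n}) ({1..N} - set js)"
    using finite_same_card_bij by (metis finite_Diff finite_atLeastAtMost)
  define \<pi> where "\<pi> i = (if i \<in> {1..?n} then f i else if i \<in> {1..N} then g i else i)" for i
  have "bij_betw \<pi> ({1..?n} \<union> ({1..N} - {1..?n})) (set js \<union> ({1..N} - set js))"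
  proof (rule bij_betw_combine)
    show "bij_betw \<pi> {1..?n} (set js)"
      using f by (subst bij_betw_cong[of _ _ f]) (auto simp: \<pi>_def)
    show "bij_betw \<pi> ({1..N} - {1..?n}) ({1..N} - set js)"
      using g by (subst bij_betw_cong[of _ _ g]) (auto simp: \<pi>_def)
  qed auto
  moreover have "{1..?n} \<union> ({1..N} - {1..?n}) = {1..N}" "set js \<union> ({1..N} - set js) = {1..N}"
    using nN assms by auto
  ultimately have "\<pi> permutes {1..N}"
    using nN by (intro bij_imp_permutes) (auto simp: \<pi>_def)
  moreover have "map \<pi> [1..<Suc ?n] = js"
    by (rule nth_equalityI) (auto simp: \<pi>_def f_def simp del: upt_Suc)
  ultimately show ?thesis by (rule that)
qed

section \<open>Laws and expectations of samples along distinct indices\<close>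

locale positive_exchangeable = prob_space M for M :: "'w measure" +
  fixes D :: "'a set" and X :: "nat \<Rightarrow> 'w \<Rightarrow> 'a"
  assumes finite_D: "finite D"
    and measurable_X: "i \<ge> 1 \<Longrightarrow> X i \<in> M \<rightarrow>\<^sub>M count_space D"
    and exchangeable_X: "exchangeable M (count_space D) X"
    and positive_X: "n \<ge> 1 \<Longrightarrow> x \<in> {1..n} \<rightarrow>\<^sub>E D \<Longrightarrow> \<P>(\<omega> in M. \<forall>i\<in>{1..n}. X i \<omega> = x i) > 0"
begin

abbreviation "sample js \<omega> \<equiv> map (\<lambda>j. X j \<omega>) js"

definition law :: "'a list \<Rightarrow> real" where
  "law xs = prob {\<omega> \<in> space M. sample [1..<Suc (length xs)] \<omega> = xs}"

lemma X_in_D: "i \<ge> 1 \<Longrightarrow> \<omega> \<in> space M \<Longrightarrow> X i \<omega> \<in> D"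
  using measurable_space[OF measurable_X] by fastforce

lemma sample_in_words:
  "set js \<subseteq> {1..} \<Longrightarrow> \<omega> \<in> space M \<Longrightarrow> sample js \<omega> \<in> words D (length js)"
  by (auto simp: words_def intro!: X_in_D)

lemma sample_eq_sets:
  assumes "set js \<subseteq> {1..}"
  shows "{\<omega> \<in> space M. sample js \<omega> = xs} \<in> sets M"
  using assms
proof (induction js arbitrary: xs)
  case (Cons j js)
  show ?case
  proof (cases xs)
    case (Cons x ys)
    have j: "{\<omega> \<in> space M. X j \<omega> = x} \<in> sets M"
    proof (cases "x \<in> D")
      case True
      then have "X j -` {x} \<inter> space M \<in> sets M"
        using Cons.prems by (intro measurable_sets[OF measurable_X]) auto
      moreover have "X j -` {x} \<inter> space M = {\<omega> \<in> space M. X j \<omega> = x}" by auto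
      ultimately show ?thesis by simp
    next
      case False
      then have *: "{\<omega> \<in> space M. X j \<omega> = x} = {}" using X_in_D[of j] Cons.prems by auto
      show ?thesis unfolding * by (rule sets.empty_sets)
    qed
    have "{\<omega> \<in> space M. sample (j # js) \<omega> = xs}
        = {\<omega> \<in> space M. X j \<omega> = x} \<inter> {\<omega> \<in> space M. sample js \<omega> = ys}"
      using Cons by auto
    moreover have "{\<omega> \<in> space M. sample js \<omega> = ys} \<in> sets M" using Cons.IH Cons.prems by simp
    ultimately show ?thesis using sets.Int[OF j] by simp
  qed simp
qed simp

lemma prob_sample_eq:
  assumes "distinct js" "set js \<subseteq> {1..}" "length js = length xs"
  shows "prob {\<omega> \<in> space M. sample js \<omega> = xs} = law xs"
proof -
  \<comment> \<open>The block must contain the indices in \<open>js\<close> and the initial segment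
    that is mapped onto them; \<open>exchangeable\<close> starts at blocks of length 2.\<close>
  obtain N where N: "N \<ge> 2" "set js \<subseteq> {1..N}" "length js \<le> N"
  proof
    let ?N = "max 2 (Max (insert 0 (set js)))"
    show "?N \<ge> 2" by simp
    show *: "set js \<subseteq> {1..?N}" using assms by (fastforce simp: le_max_iff_disj)
    show "length js \<le> ?N"
      using card_mono[OF _ *] assms distinct_card[of js] by simp
  qed
  obtain \<pi> where \<pi>: "\<pi> permutes {1..N}" "map \<pi> [1..<Suc (length js)] = js"
    using permutation_extending_list[OF assms(1) N(2)] by blast
  let ?P = "\<Pi>\<^sub>M i\<in>{1..N}. count_space D"
  let ?is = "[1..<Suc (length js)]"
  define A where "A = {x \<in> {1..N} \<rightarrow>\<^sub>E D. map x ?is = xs}"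
  \<comment> \<open>Finiteness of \<open>D\<close> makes the product sigma-algebra discrete, so the
    event \<open>A\<close> is measurable.\<close>
  have "sets ?P = Pow ({1..N} \<rightarrow>\<^sub>E D)"
    using finite_D by (subst count_space_PiM_finite) (auto intro: countable_finite)
  then have A: "A \<in> sets ?P" by (auto simp: A_def)
  have measX: "(\<lambda>\<omega>. \<lambda>i\<in>{1..N}. X (\<sigma> i) \<omega>) \<in> M \<rightarrow>\<^sub>M ?P" if "\<sigma> permutes {1..N}" for \<sigma>
  proof (rule measurable_restrict)
    fix i assume "i \<in> {1..N}"
    then have "\<sigma> i \<in> {1..N}" using that by (metis permutes_in_image)
    then show "X (\<sigma> i) \<in> M \<rightarrow>\<^sub>M count_space D" by (intro measurable_X) auto
  qed
  have "measure (distr M ?P (\<lambda>\<omega>. \<lambda>i\<in>{1..N}. X (\<sigma> i) \<omega>)) A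
      = prob {\<omega> \<in> space M. sample (map \<sigma> ?is) \<omega> = xs}" if \<sigma>: "\<sigma> permutes {1..N}" for \<sigma>
  proof -
    have "(\<lambda>\<omega>. \<lambda>i\<in>{1..N}. X (\<sigma> i) \<omega>) -` A \<inter> space M = {\<omega> \<in> space M. sample (map \<sigma> ?is) \<omega> = xs}"
    proof -
      have "map (\<lambda>i\<in>{1..N}. X (\<sigma> i) \<omega>) ?is = sample (map \<sigma> ?is) \<omega>" for \<omega>
        using N(3) by (auto simp del: upt_Suc)
      moreover have "(\<lambda>i\<in>{1..N}. X (\<sigma> i) \<omega>) \<in> {1..N} \<rightarrow>\<^sub>E D" if "\<omega> \<in> space M" for \<omega>
        using measurable_space[OF measX[OF \<sigma>] that] by (simp add: space_PiM)
      ultimately show ?thesis by (auto simp: A_def simp del: upt_Suc)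
    qed
    then show ?thesis by (simp only: measure_distr[OF measX[OF \<sigma>] A])
  qed
  note eq = this
  have "distr M ?P (\<lambda>\<omega>. \<lambda>i\<in>{1..N}. X (\<pi> i) \<omega>) = distr M ?P (\<lambda>\<omega>. \<lambda>i\<in>{1..N}. X (id i) \<omega>)"
    using exchangeable_X N(1) \<pi>(1) unfolding exchangeable_def by auto
  then have "prob {\<omega> \<in> space M. sample (map \<pi> ?is) \<omega> = xs} = prob {\<omega> \<in> space M. sample (map id ?is) \<omega> = xs}"
    using eq[OF \<pi>(1)] eq[OF permutes_id] by metis
  then show ?thesis unfolding \<pi>(2) by (simp only: law_def assms(3) list.map_id)
qed

text \<open>Rearranging the word amounts to rearranging the list of indices along which the sequence
  is read, and by \<open>prob_sample_eq\<close> that list does not matter.\<close>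

lemma law_cong_mset:
  assumes "mset xs = mset ys"
  shows "law xs = law ys"
proof -
  have len: "length xs = length ys" using assms by (rule mset_eq_length)
  obtain p where p: "p permutes {..<length ys}" "permute_list p ys = xs"
    using mset_eq_permutation[OF assms] by blast
  let ?is = "[1..<Suc (length ys)]"
  let ?js = "permute_list p ?is"
  have m: "mset ?js = mset ?is" using p by (intro mset_permute_list) (simp del: upt_Suc)
  have sample_eq: "sample ?js \<omega> = permute_list p (sample ?is \<omega>)" for \<omega>
    using p by (intro permute_list_map[symmetric]) (simp del: upt_Suc)
  have "sample ?js \<omega> = xs \<longleftrightarrow> sample ?is \<omega> = ys" for \<omega>
  proof
    assume "sample ?js \<omega> = xs"
    then have eq: "permute_list p (sample ?is \<omega>) = permute_list p ys" using p sample_eq by simp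
    show "sample ?is \<omega> = ys"
    proof (rule nth_equalityI)
      fix i assume "i < length (sample ?is \<omega>)"
      then have i: "i < length ys" by (simp del: upt_Suc)
      then obtain j where j: "j < length ys" "p j = i"
        using p(1) by (metis lessThan_iff permutes_def permutes_in_image)
      then show "sample ?is \<omega> ! i = ys ! i"
        using arg_cong[OF eq, of "\<lambda>l. l ! j"] p(1) by (simp add: permute_list_nth del: upt_Suc)
    qed (simp del: upt_Suc)
  next
    assume "sample ?is \<omega> = ys"
    then show "sample ?js \<omega> = xs" using p sample_eq by simp
  qed
  then have "prob {\<omega> \<in> space M. sample ?js \<omega> = xs} = law ys"
    unfolding law_def by (simp del: upt_Suc)
  moreover have "prob {\<omega> \<in> space M. sample ?js \<omega> = xs} = law xs"
  proof (rule prob_sample_eq)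
    show "distinct ?js" using m by (metis distinct_upt mset_eq_imp_distinct_iff)
    show "set ?js \<subseteq> {1..}" using mset_eq_setD[OF m] by auto
  qed (simp add: len del: upt_Suc)
  ultimately show ?thesis by simp
qed

lemma law_pos:
  assumes "xs \<in> words D n"
  shows "law xs > 0"
proof (cases n)
  case 0
  then show ?thesis using assms by (simp add: words_def law_def prob_space)
next
  case (Suc k)
  define x where "x = (\<lambda>i\<in>{1..n}. xs ! (i - 1))"
  have len: "length xs = n" using assms by (simp add: words_def)
  have "x \<in> {1..n} \<rightarrow>\<^sub>E D" using assms by (auto simp: x_def words_def intro!: subsetD[OF _ nth_mem])
  then have "\<P>(\<omega> in M. \<forall>i\<in>{1..n}. X i \<omega> = x i) > 0" using Suc by (intro positive_X) auto
  moreover have "(\<forall>i\<in>{1..n}. X i \<omega> = x i) \<longleftrightarrow> sample [1..<Suc n] \<omega> = xs" for \<omega>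
  proof
    assume "\<forall>i\<in>{1..n}. X i \<omega> = x i"
    then show "sample [1..<Suc n] \<omega> = xs"
      by (intro nth_equalityI) (auto simp: x_def len simp del: upt_Suc)
  next
    assume "sample [1..<Suc n] \<omega> = xs"
    then show "\<forall>i\<in>{1..n}. X i \<omega> = x i" by (auto simp: x_def simp del: upt_Suc)
  qed
  ultimately show ?thesis by (simp add: law_def len del: upt_Suc)
qed

lemma expectation_sample:
  fixes f :: "'a list \<Rightarrow> real"
  assumes "distinct js" "set js \<subseteq> {1..}" "n = length js"
  shows "integrable M (\<lambda>\<omega>. f (sample js \<omega>))"
    and "(\<integral>\<omega>. f (sample js \<omega>) \<partial>M) = (\<Sum>xs\<in>words D n. law xs * f xs)"
proof -
  let ?A = "\<lambda>xs. {\<omega> \<in> space M. sample js \<omega> = xs}"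
  have sum: "f (sample js \<omega>) = (\<Sum>xs\<in>words D n. f xs * indicator (?A xs) \<omega>)" if "\<omega> \<in> space M" for \<omega>
  proof -
    have "(\<Sum>xs\<in>words D n. f xs * indicator (?A xs) \<omega>)
        = (\<Sum>xs\<in>words D n. if xs = sample js \<omega> then f xs else 0)"
      using that by (intro sum.cong) (auto simp: indicator_def)
    also have "\<dots> = f (sample js \<omega>)"
      using sample_in_words[OF assms(2) that] finite_D assms(3) by simp
    finally show ?thesis ..
  qed
  have int: "integrable M (\<lambda>\<omega>. f xs * indicator (?A xs) \<omega>)" for xs
    using sample_eq_sets[OF assms(2)] by (intro integrable_mult_right) (simp add: fmeasurable_eq_sets integrable_indicator_iff emeasure_eq_measure)
  show "integrable M (\<lambda>\<omega>. f (sample js \<omega>))"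
    using int by (subst Bochner_Integration.integrable_cong[OF refl sum]) auto
  have "(\<integral>\<omega>. f (sample js \<omega>) \<partial>M) = (\<integral>\<omega>. (\<Sum>xs\<in>words D n. f xs * indicator (?A xs) \<omega>) \<partial>M)"
    using sum by (intro Bochner_Integration.integral_cong) auto
  also have "\<dots> = (\<Sum>xs\<in>words D n. f xs * prob (?A xs))"
    using int sample_eq_sets[OF assms(2)] by (subst Bochner_Integration.integral_sum) (auto simp: Int_def conj_commute conj_left_commute)
  also have "\<dots> = (\<Sum>xs\<in>words D n. law xs * f xs)"
    using prob_sample_eq[OF assms(1,2)] assms(3) by (intro sum.cong) (auto simp: words_def)
  finally show "(\<integral>\<omega>. f (sample js \<omega>) \<partial>M) = (\<Sum>xs\<in>words D n. law xs * f xs)" .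
qed

end

section \<open>Symmetric statistics and the raising operator\<close>

definition ustat :: "(nat \<Rightarrow> 'a) \<Rightarrow> nat set \<Rightarrow> nat \<Rightarrow> ('a multiset \<Rightarrow> real) \<Rightarrow> real" where
  "ustat x S k \<phi> = (\<Sum>J | J \<subseteq> S \<and> card J = k. \<phi> (image_mset x (mset_set J)))"

text \<open>For \<open>\<phi>\<close> of order \<open>k\<close>, the value on a family of
  \<open>k + 1\<close> letters is the order \<open>k\<close> U-statistic of that family; a repeated
  letter is deleted once per occurrence.\<close>

definition raise :: "('a multiset \<Rightarrow> real) \<Rightarrow> 'a multiset \<Rightarrow> real" where
  "raise \<phi> A = (\<Sum>x\<in>#A. \<phi> (A - {#x#}))"

lemma raise_image_mset:
  assumes "finite J"
  shows "raise \<phi> (image_mset x (mset_set J)) = (\<Sum>j\<in>J. \<phi> (image_mset x (mset_set (J - {j}))))"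
proof -
  have "raise \<phi> (image_mset x (mset_set J)) = (\<Sum>j\<in>J. \<phi> (image_mset x (mset_set J) - {#x j#}))"
    unfolding raise_def by (simp add: image_mset.compositionality o_def sum_unfold_sum_mset)
  also have "\<dots> = (\<Sum>j\<in>J. \<phi> (image_mset x (mset_set (J - {j}))))"
    using assms by (intro sum.cong refl) (simp add: mset_set.remove)
  finally show ?thesis .
qed

text \<open>Double counting of a set of size \<open>k + 1\<close> with an element to delete: each
  set of size \<open>k\<close> arises once for every index outside it.\<close>

lemma ustat_raise:
  assumes "finite S" "k \<le> card S"
  shows "ustat x S (Suc k) (raise \<phi>) = (card S - k) * ustat x S k \<phi>"
proof -
  let ?P = "\<lambda>k. {J. J \<subseteq> S \<and> card J = k}"
  have fin: "finite (?P k)" for k using assms by auto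
  have finJ: "finite J" if "J \<subseteq> S" for J using that assms finite_subset by blast
  have "ustat x S (Suc k) (raise \<phi>) = (\<Sum>J\<in>?P (Suc k). \<Sum>j\<in>J. \<phi> (image_mset x (mset_set (J - {j}))))"
    unfolding ustat_def by (intro sum.cong refl raise_image_mset finJ) auto
  also have "\<dots> = (\<Sum>(J, j)\<in>Sigma (?P (Suc k)) (\<lambda>J. J). \<phi> (image_mset x (mset_set (J - {j}))))"
    using fin finJ by (intro sum.Sigma) auto
  also have "\<dots> = (\<Sum>(I, j)\<in>Sigma (?P k) (\<lambda>I. S - I). \<phi> (image_mset x (mset_set I)))"
    by (rule sum.reindex_bij_witness[where i = "\<lambda>(I, j). (insert j I, j)" and j = "\<lambda>(J, j). (J - {j}, j)"])
       (use finJ in \<open>auto simp: card_Diff_singleton insert_absorb card_insert_if\<close>)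
  also have "\<dots> = (\<Sum>I\<in>?P k. \<Sum>j\<in>S - I. \<phi> (image_mset x (mset_set I)))"
    using fin assms by (intro sum.Sigma[symmetric]) auto
  also have "\<dots> = (\<Sum>I\<in>?P k. (card S - k) * \<phi> (image_mset x (mset_set I)))"
    using finJ by (intro sum.cong refl) (auto simp: card_Diff_subset)
  finally show ?thesis by (simp add: ustat_def sum_distrib_left)
qed

lemma ustat_full:
  assumes "finite S"
  shows "ustat x S (card S) \<phi> = \<phi> (image_mset x (mset_set S))"
proof -
  have "{J. J \<subseteq> S \<and> card J = card S} = {S}"
    using assms card_subset_eq by auto
  then show ?thesis by (simp add: ustat_def)
qed

lemma image_mset_nth: "length xs = n \<Longrightarrow> image_mset (\<lambda>i. xs ! (i - 1)) (mset_set {1..n}) = mset xs"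
proof -
  assume "length xs = n"
  then have "xs = map (\<lambda>i. xs ! (i - 1)) [1..<Suc n]"
    by (intro nth_equalityI) (auto simp del: upt_Suc)
  then have "mset xs = image_mset (\<lambda>i. xs ! (i - 1)) (mset [1..<Suc n])"
    by (metis mset_map)
  also have "mset [1..<Suc n] = mset_set {1..n}"
    by (simp add: atLeastLessThanSuc_atLeastAtMost del: upt_Suc)
  finally show ?thesis by simp
qed

text \<open>Repeated raising turns a statistic of order \<open>k\<close> into one of full order \<open>n\<close>,
  which is visibly a function of the multiset of the entries.\<close>

lemma ustat_cong_mset:
  assumes "length xs = n" "mset xs = mset ys" "k \<le> n"
  shows "ustat (\<lambda>i. xs ! (i - 1)) {1..n} k \<phi> = ustat (\<lambda>i. ys ! (i - 1)) {1..n} k \<phi>"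
  using assms(3)
proof (induction k arbitrary: \<phi> rule: inc_induct)
  case base
  have "length ys = n" using assms mset_eq_length by metis
  then show ?case
    using image_mset_nth[of xs n] image_mset_nth[of ys n] assms
      ustat_full[of "{1..n}" _ \<phi>] by simp
next
  case (step k)
  have "real (n - k) * ustat (\<lambda>i. zs ! (i - 1)) {1..n} k \<phi>
      = ustat (\<lambda>i. zs ! (i - 1)) {1..n} (Suc k) (raise \<phi>)" for zs
    using ustat_raise[of "{1..n}" k _ \<phi>] step.hyps by simp
  then have "real (n - k) * ustat (\<lambda>i. xs ! (i - 1)) {1..n} k \<phi>
      = real (n - k) * ustat (\<lambda>i. ys ! (i - 1)) {1..n} k \<phi>"
    using step.IH by metis
  then show ?case using step.hyps by (metis mult_left_cancel of_nat_eq_0_iff zero_less_diff less_irrefl)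
qed

text \<open>Adding a fixed letter \<open>e\<close> to \<open>B\<close> and then deleting a letter
  gives back \<open>B\<close> or a multiset with more copies of \<open>e\<close>. By induction the
  latter contribute nothing, and \<open>B\<close> arises \<open>1 + count B e\<close> times. This is
  the injectivity of \<open>raise\<close>.\<close>

lemma raise_eq_0_imp:
  assumes "e \<in> D"
    and raise0: "\<And>A. set_mset A \<subseteq> D \<Longrightarrow> size A = Suc k \<Longrightarrow> raise \<phi> A = 0"
    and "set_mset B \<subseteq> D" "size B = k"
  shows "\<phi> B = 0"
  using assms(3,4)
proof (induction "k - count B e" arbitrary: B rule: less_induct)
  case less
  have "\<phi> (add_mset e B - {#x#}) = (if x = e then \<phi> B else 0)" if "x \<in># B" for x
  proof (cases "x = e")
    case False
    let ?C = "add_mset e B - {#x#}"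
    obtain C where "B = add_mset x C" using multi_member_split[OF \<open>x \<in># B\<close>] by blast
    then have "count B e < k"
      using False less.prems(2) count_le_size[of C e] by auto
    then have "k - count ?C e < k - count B e" using False by simp
    moreover have "set_mset ?C \<subseteq> D" using less.prems assms(1) by (auto dest!: in_diffD)
    moreover have "size ?C = k" using less.prems that by (subst size_Diff_singleton) auto
    ultimately show ?thesis using less.hyps False by simp
  qed simp
  then have "(\<Sum>x\<in>#B. \<phi> (add_mset e B - {#x#})) = (\<Sum>x\<in>#B. if x = e then \<phi> B else 0)"
    by (intro arg_cong[of _ _ sum_mset] image_mset_cong) auto
  also have "\<dots> = count B e * \<phi> B"
    by (simp add: sum_mset_delta)
  finally have "raise \<phi> (add_mset e B) = (1 + count B e) * \<phi> B"
    by (simp add: raise_def algebra_simps)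
  moreover have "raise \<phi> (add_mset e B) = 0"
    using less.prems assms(1) by (intro raise0) auto
  ultimately show ?case by (simp add: add_nonneg_eq_0_iff)
qed

text \<open>Injectivity descends from full order, where the statistic evaluates its kernel: if the
  order \<open>k\<close> statistic vanishes, so does the order \<open>k + 1\<close> statistic of the
  raised kernel, and \<open>raise\<close> is injective.\<close>

lemma ustat_eq_0_imp:
  assumes "e \<in> D" "k \<le> n"
    and "\<And>xs. xs \<in> words D n \<Longrightarrow> ustat (\<lambda>i. xs ! (i - 1)) {1..n} k \<phi> = 0"
    and "set_mset B \<subseteq> D" "size B = k"
  shows "\<phi> B = 0"
  using assms(2-)
proof (induction k arbitrary: \<phi> B rule: inc_induct)
  case base
  obtain xs where xs: "mset xs = B" using ex_mset by blast
  then have "xs \<in> words D n" using base.prems by (auto simp: words_def)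
  then show ?case
    using base.prems(1)[of xs] ustat_full[of "{1..n}" _ \<phi>] image_mset_nth[of xs n] xs
    by (simp add: words_def)
next
  case (step k)
  have "ustat (\<lambda>i. xs ! (i - 1)) {1..n} (Suc k) (raise \<phi>) = 0" if "xs \<in> words D n" for xs
    using step ustat_raise[of "{1..n}" k _ \<phi>] that by simp
  then have "raise \<phi> A = 0" if "set_mset A \<subseteq> D" "size A = Suc k" for A
    using step.IH that by simp
  then show ?case by (rule raise_eq_0_imp[OF assms(1)]) (use step.prems in auto)
qed

text \<open>Gram-Schmidt in the inner product weighted by \<open>w\<close>, one spanning function at
  a time: the residuals of \<open>f\<close> and of the new \<open>g a\<close> against the old span
  are formed, and the former is projected off the latter. The \<open>g i\<close> may be linearly
  dependent.\<close>

lemma weighted_projection: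
  fixes w :: "'b \<Rightarrow> real" and g :: "'i \<Rightarrow> 'b \<Rightarrow> real"
  assumes "finite S" "\<And>x. x \<in> S \<Longrightarrow> w x > 0" "finite I"
  shows "\<exists>c. \<forall>j\<in>I. (\<Sum>x\<in>S. w x * (f x - (\<Sum>i\<in>I. c i * g i x)) * g j x) = 0"
  using assms(3)
proof (induction I arbitrary: f rule: finite_induct)
  case (insert a I)
  let ?ip = "\<lambda>f g. \<Sum>x\<in>S. w x * f x * g x"
  let ?lc = "\<lambda>c x. \<Sum>i\<in>I. c i * g i x"
  obtain c where c: "\<forall>j\<in>I. ?ip (\<lambda>x. f x - ?lc c x) (g j) = 0" using insert.IH by blast
  obtain b where b: "\<forall>j\<in>I. ?ip (\<lambda>x. g a x - ?lc b x) (g j) = 0" using insert.IH by blast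
  define f' where "f' x = f x - ?lc c x" for x
  define h where "h x = g a x - ?lc b x" for x
  \<comment> \<open>If \<open>h\<close> has norm 0, it vanishes on \<open>S\<close> because
    \<open>w\<close> is positive there; then both sides of the next equation are 0 whatever the
    value of the quotient.\<close>
  define t where "t = ?ip f' h / ?ip h h"
  have t: "?ip f' h = t * ?ip h h"
  proof (cases "?ip h h = 0")
    case True
    have "\<forall>x\<in>S. w x * h x * h x = 0"
      using True assms(1,2) by (subst (asm) sum_nonneg_eq_0_iff) (auto simp: mult.assoc less_imp_le)
    then have "\<forall>x\<in>S. h x = 0" using assms(2) by force
    then show ?thesis by simp
  qed (simp add: t_def)
  define r where "r x = f' x - t * h x" for x
  have rI: "?ip r (g j) = 0" if "j \<in> I" for j
  proof -
    have "?ip r (g j) = ?ip f' (g j) - t * ?ip h (g j)"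
      by (simp add: r_def algebra_simps sum_subtractf sum_distrib_left)
    then show ?thesis using b c that by (simp add: f'_def h_def)
  qed
  have "?ip r h = 0"
    using t by (simp add: r_def algebra_simps sum_subtractf sum_distrib_left)
  moreover have "?ip r (?lc b) = (\<Sum>j\<in>I. b j * ?ip r (g j))"
    by (subst sum_distrib_left, subst sum.swap)
       (intro sum.cong refl, simp add: sum_distrib_left mult_ac)
  ultimately have ra: "?ip r (g a) = 0"
    using rI by (simp add: h_def algebra_simps sum_subtractf)
  define e where "e i = (if i = a then t else c i - t * b i)" for i
  have "f x - (\<Sum>i\<in>insert a I. e i * g i x) = r x" for x
  proof -
    have "(\<Sum>i\<in>I. e i * g i x) = ?lc c x - t * ?lc b x"
      unfolding sum_distrib_left sum_subtractf[symmetric]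
      using insert.hyps by (intro sum.cong refl) (auto simp: e_def algebra_simps)
    then show ?thesis
      using insert.hyps by (simp add: e_def r_def f'_def h_def algebra_simps)
  qed
  then show ?case using rI ra by (intro exI[of _ e]) auto
qed simp

section \<open>Passing between kernels on lists and kernels on multisets\<close>

definition mset_kernel :: "('a list \<Rightarrow> real) \<Rightarrow> 'a multiset \<Rightarrow> real" where
  "mset_kernel \<phi> A = \<phi> (SOME xs. mset xs = A)"

lemma mset_kernel_eq:
  assumes "symmetric_kernel D k \<phi>" "set xs \<subseteq> D" "length xs = k"
  shows "mset_kernel \<phi> (mset xs) = \<phi> xs"
proof -
  have "mset (SOME ys. mset ys = mset xs) = mset xs" by (rule someI[of _ xs]) simp
  then show ?thesis using assms unfolding symmetric_kernel_def mset_kernel_def by metis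
qed

lemma symmetric_kernel_mset: "symmetric_kernel D k (\<lambda>xs. \<phi> (mset xs))"
  by (simp add: symmetric_kernel_def)

lemma mset_subvec: "finite J \<Longrightarrow> mset (subvec X J \<omega>) = image_mset (\<lambda>j. X j \<omega>) (mset_set J)"
  using mset_set_set[of "sorted_list_of_set J"] by (simp add: subvec_def)

lemma U_stat_eq_ustat:
  assumes "symmetric_kernel D k \<phi>" "\<And>i. i \<in> {1..n} \<Longrightarrow> X i \<omega> \<in> D"
  shows "U_stat X n k \<phi> \<omega> = ustat (\<lambda>i. X i \<omega>) {1..n} k (mset_kernel \<phi>)"
  unfolding U_stat_def ustat_def
proof (intro sum.cong refl)
  fix J assume J: "J \<in> {J. J \<subseteq> {1..n} \<and> card J = k}"
  then have "finite J" by (auto intro: finite_subset)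
  moreover have "set (subvec X J \<omega>) \<subseteq> D" "length (subvec X J \<omega>) = k"
    using J \<open>finite J\<close> assms(2) by (auto simp: subvec_def)
  ultimately show "\<phi> (subvec X J \<omega>) = mset_kernel \<phi> (image_mset (\<lambda>i. X i \<omega>) (mset_set J))"
    using mset_kernel_eq[OF assms(1), of "subvec X J \<omega>"] by (simp add: mset_subvec)
qed

lemma U_stat_mset: "U_stat X n k (\<lambda>xs. \<phi> (mset xs)) \<omega> = ustat (\<lambda>i. X i \<omega>) {1..n} k \<phi>"
  unfolding U_stat_def ustat_def by (intro sum.cong refl) (auto simp: mset_subvec finite_subset)

lemma U_stat_in_Ls:
  assumes "symmetric_kernel D k \<phi>" "k \<le> n"
  shows "U_stat X n k \<phi> \<in> Ls D X n"
proof -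
  \<comment> \<open>The list is replayed as a deterministic sequence over a one-point sample
    space.\<close>
  define T where "T xs = U_stat (\<lambda>i _. xs ! (i - 1)) n k \<phi> ()" for xs
  have "symmetric_kernel D n T"
    unfolding symmetric_kernel_def
  proof (intro allI impI)
    fix xs ys :: "'a list"
    assume *: "length xs = n" "set xs \<subseteq> D" "mset xs = mset ys"
    then have **: "length ys = n" "set ys \<subseteq> D" by (metis mset_eq_length, metis mset_eq_setD)
    have "T zs = ustat (\<lambda>i. zs ! (i - 1)) {1..n} k (mset_kernel \<phi>)"
      if "length zs = n" "set zs \<subseteq> D" for zs
      unfolding T_def using that by (intro U_stat_eq_ustat[OF assms(1)]) (auto intro!: subsetD[OF _ nth_mem])
    then show "T xs = T ys" using * ** ustat_cong_mset[OF *(1,3) assms(2)] by metis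
  qed
  moreover have "U_stat X n k \<phi> = (\<lambda>\<omega>. T (subvec X {1..n} \<omega>))"
  proof
    fix \<omega>
    have "subvec X {1..n} \<omega> ! (i - 1) = X i \<omega>" if "i \<in> {1..n}" for i
    proof -
      have "sorted_list_of_set {1..n} = [1..<Suc n]"
        by (metis atLeastLessThanSuc_atLeastAtMost sorted_list_of_set_range)
      then show ?thesis using that by (cases i) (simp_all add: subvec_def del: upt_Suc)
    qed
    then have "subvec (\<lambda>i _. subvec X {1..n} \<omega> ! (i - 1)) J () = subvec X J \<omega>"
      if "J \<subseteq> {1..n}" for J :: "nat set"
      using that finite_subset[OF that] unfolding subvec_def[of _ J] by (intro map_cong) auto
    then show "U_stat X n k \<phi> \<omega> = T (subvec X {1..n} \<omega>)"
      unfolding T_def U_stat_def by (intro sum.cong) auto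
  qed
  ultimately show ?thesis unfolding Ls_def by blast
qed

lemma raise_sum:
  fixes f :: "'i \<Rightarrow> 'a multiset \<Rightarrow> real"
  shows "raise (\<lambda>A. \<Sum>i\<in>I. c i * f i A) B = (\<Sum>i\<in>I. c i * raise (f i) B)"
proof (induction I rule: infinite_finite_induct)
  case (insert i I)
  then show ?case by (simp add: raise_def sum_mset.distrib sum_mset_distrib_left)
qed (simp_all add: raise_def)

lemma raise_cong: "(\<And>x. x \<in># B \<Longrightarrow> f (B - {#x#}) = g (B - {#x#})) \<Longrightarrow> raise f B = raise g B"
  unfolding raise_def by (intro arg_cong[of _ _ sum_mset] image_mset_cong)

lemma mset_words: "mset ` words D n = {A. set_mset A \<subseteq> D \<and> size A = n}"
proof (intro equalityI subsetI)
  fix A assume "A \<in> {A. set_mset A \<subseteq> D \<and> size A = n}"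
  then show "A \<in> mset ` words D n"
    using ex_mset[of A] by (force simp: words_def)
qed (auto simp: words_def)

text \<open>Exhibits the range of \<open>raise\<close> as the span of finitely many functions, the
  form in which \<open>weighted_projection\<close> can be applied.\<close>

lemma raise_delta_expansion:
  assumes "finite D" "k \<ge> 1" "A \<in> mset ` words D k"
  shows "raise \<psi> A = (\<Sum>B\<in>mset ` words D (k - 1). \<psi> B * raise (\<lambda>A. if A = B then 1 else 0) A)"
proof -
  have "raise \<psi> A = raise (\<lambda>A. \<Sum>B\<in>mset ` words D (k - 1). \<psi> B * (if A = B then 1 else 0)) A"
  proof (rule raise_cong)
    fix x assume "x \<in># A"
    then have "A - {#x#} \<in> mset ` words D (k - 1)"
      using assms(3) unfolding mset_words by (auto simp: size_Diff_singleton dest: in_diffD)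
    then show "\<psi> (A - {#x#}) = (\<Sum>B\<in>mset ` words D (k - 1). \<psi> B * (if A - {#x#} = B then 1 else 0))"
      using assms(1) by (simp add: if_distrib cong: if_cong)
  qed
  then show ?thesis by (simp only: raise_sum)
qed

section \<open>Degeneracy and Hoeffding decomposability as finite linear conditions\<close>

context positive_exchangeable
begin

text \<open>\<open>overlap_cov k u \<phi> \<psi>\<close> is the expectation of \<open>\<phi>(X\<^sub>1, \<dots>, X\<^sub>k) \<psi>(X\<^bsub>u+1\<^esub>, \<dots>, X\<^bsub>u+k-1\<^esub>)\<close>,
  where \<open>k - u\<close> indices are shared.\<close>

definition overlap_cov :: "nat \<Rightarrow> nat \<Rightarrow> ('a multiset \<Rightarrow> real) \<Rightarrow> ('a multiset \<Rightarrow> real) \<Rightarrow> real" where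
  "overlap_cov k u \<phi> \<psi> =
     (\<Sum>xs\<in>words D (k + u - 1). law xs * (\<phi> (mset (take k xs)) * \<psi> (mset (drop u xs))))"

text \<open>Each sum is the conditional expectation given that coordinates 2 to \<open>k\<close>
  form \<open>xs\<close>, multiplied by the probability of that event. For \<open>k = 1\<close> the
  only \<open>xs\<close> is the empty word.\<close>

definition degenerate :: "nat \<Rightarrow> ('a multiset \<Rightarrow> real) \<Rightarrow> bool" where
  "degenerate k \<phi> \<longleftrightarrow> (\<forall>xs\<in>words D (k - 1). (\<Sum>x\<in>D. law (x # xs) * \<phi> (mset (x # xs))) = 0)"

text \<open>List the indices as \<open>J - I\<close>, then the intersection, then
  \<open>I - J\<close>: \<open>\<phi>\<close> reads the first \<open>k\<close> entries and
  \<open>\<psi>\<close> those after the first \<open>?u\<close>. Since expectations ignore which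
  distinct indices are listed, only the size of the overlap survives.\<close>

lemma expectation_product:
  assumes "J \<subseteq> {1..n}" "I \<subseteq> {1..n}" "card J = k" "card I = k - 1" "k \<ge> 1"
  shows "integrable M (\<lambda>\<omega>. \<phi> (image_mset (\<lambda>i. X i \<omega>) (mset_set J)) * \<psi> (image_mset (\<lambda>i. X i \<omega>) (mset_set I)))"
    (is "integrable M ?f")
    and "(\<integral>\<omega>. \<phi> (image_mset (\<lambda>i. X i \<omega>) (mset_set J)) * \<psi> (image_mset (\<lambda>i. X i \<omega>) (mset_set I)) \<partial>M)
       = overlap_cov k (k - card (J \<inter> I)) \<phi> \<psi>"
proof -
  have fin: "finite J" "finite I" using assms finite_subset by auto
  define as bs cs where "as = sorted_list_of_set (J - I)" and "bs = sorted_list_of_set (J \<inter> I)"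
    and "cs = sorted_list_of_set (I - J)"
  let ?u = "k - card (J \<inter> I)"
  have le: "card (J \<inter> I) \<le> k - 1" using assms(4) fin card_mono[of I "J \<inter> I"] by auto
  have len: "length as = ?u" "length bs = card (J \<inter> I)" "length cs = k - 1 - card (J \<inter> I)"
    using fin assms card_Diff_subset_Int[of J I] card_Diff_subset_Int[of I J]
    by (auto simp: as_def bs_def cs_def Int_commute)
  have ms: "mset as = mset_set (J - I)" "mset bs = mset_set (J \<inter> I)" "mset cs = mset_set (I - J)"
    unfolding as_def bs_def cs_def using fin by (simp_all flip: mset_set_set)
  have dist: "distinct (as @ bs @ cs)" and set: "set (as @ bs @ cs) \<subseteq> {1..}"
    using fin assms(1,2) by (auto simp: as_def bs_def cs_def)
  have n: "k + ?u - 1 = length (as @ bs @ cs)" using len le assms(5) by simp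
  have "mset as + mset bs = mset_set J" "mset bs + mset cs = mset_set I"
    unfolding ms using fin by (subst mset_set_Union[symmetric]; force intro: arg_cong[of _ _ mset_set])+
  then have 1: "mset (take k (sample (as @ bs @ cs) \<omega>)) = image_mset (\<lambda>i. X i \<omega>) (mset_set J)"
    "mset (drop ?u (sample (as @ bs @ cs) \<omega>)) = image_mset (\<lambda>i. X i \<omega>) (mset_set I)" for \<omega>
    using len le assms(5) by (simp_all flip: image_mset_union)
  let ?F = "\<lambda>xs. \<phi> (mset (take k xs)) * \<psi> (mset (drop ?u xs))"
  have "?f = (\<lambda>\<omega>. ?F (sample (as @ bs @ cs) \<omega>))" using 1 by auto
  then show "integrable M ?f" "(\<integral>\<omega>. ?f \<omega> \<partial>M) = overlap_cov k ?u \<phi> \<psi>"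
    using expectation_sample[OF dist set n, of ?F] by (simp_all add: overlap_cov_def)
qed

lemma expectation_ustat_product:
  assumes "1 \<le> k"
  shows "(\<integral>\<omega>. ustat (\<lambda>i. X i \<omega>) {1..n} k \<phi> * ustat (\<lambda>i. X i \<omega>) {1..n} (k - 1) \<psi> \<partial>M)
       = (\<Sum>J | J \<subseteq> {1..n} \<and> card J = k. \<Sum>I | I \<subseteq> {1..n} \<and> card I = k - 1.
            overlap_cov k (k - card (J \<inter> I)) \<phi> \<psi>)"
proof -
  let ?P = "\<lambda>k. {J. J \<subseteq> {1..n} \<and> card J = k}"
  have fin: "finite (?P k)" for k by auto
  have "(\<integral>\<omega>. ustat (\<lambda>i. X i \<omega>) {1..n} k \<phi> * ustat (\<lambda>i. X i \<omega>) {1..n} (k - 1) \<psi> \<partial>M)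
      = (\<integral>\<omega>. (\<Sum>J\<in>?P k. \<Sum>I\<in>?P (k - 1).
          \<phi> (image_mset (\<lambda>i. X i \<omega>) (mset_set J)) * \<psi> (image_mset (\<lambda>i. X i \<omega>) (mset_set I))) \<partial>M)"
    by (simp add: ustat_def sum_product)
  also have "\<dots> = (\<Sum>J\<in>?P k. \<Sum>I\<in>?P (k - 1). overlap_cov k (k - card (J \<inter> I)) \<phi> \<psi>)"
    using expectation_product assms
    by (subst Bochner_Integration.integral_sum, force intro!: Bochner_Integration.integrable_sum,
        intro sum.cong refl, subst Bochner_Integration.integral_sum)
       (auto intro!: sum.cong)
  finally show ?thesis .
qed

lemma overlap_cov_1:
  assumes "k \<ge> 1"
  shows "overlap_cov k 1 \<phi> \<psi>
       = (\<Sum>xs\<in>words D (k - 1). \<psi> (mset xs) * (\<Sum>x\<in>D. law (x # xs) * \<phi> (mset (x # xs))))"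
proof -
  have "overlap_cov k 1 \<phi> \<psi> = (\<Sum>xs\<in>words D (Suc (k - 1)). law xs * (\<phi> (mset (take k xs)) * \<psi> (mset (drop 1 xs))))"
    using assms by (simp add: overlap_cov_def)
  also have "\<dots> = (\<Sum>xs\<in>words D (k - 1). \<psi> (mset xs) * (\<Sum>x\<in>D. law (x # xs) * \<phi> (mset (x # xs))))"
    using assms unfolding sum_words_Suc
    by (intro sum.cong refl) (auto simp: sum_distrib_left mult_ac words_def take_Cons')
  finally show ?thesis .
qed

text \<open>The test functions \<open>\<psi>\<close> cannot separate rearrangements of a word, but
  neither can the inner sum \<open>?g\<close>, since the law is symmetric. An indicator therefore
  returns \<open>?g ys\<close> times the positive number of rearrangements of
  \<open>ys\<close>.\<close>

lemma degenerate_iff_overlap_cov: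
  assumes "k \<ge> 1"
  shows "degenerate k \<phi> \<longleftrightarrow> (\<forall>\<psi>. overlap_cov k 1 \<phi> \<psi> = 0)"
proof
  assume *: "\<forall>\<psi>. overlap_cov k 1 \<phi> \<psi> = 0"
  let ?g = "\<lambda>xs. \<Sum>x\<in>D. law (x # xs) * \<phi> (mset (x # xs))"
  show "degenerate k \<phi>"
    unfolding degenerate_def
  proof
    fix ys assume ys: "ys \<in> words D (k - 1)"
    have g: "?g xs = ?g ys" if "mset xs = mset ys" for xs
      using that by (intro sum.cong refl) (simp add: law_cong_mset[of "_ # xs" "_ # ys"])
    have "0 = (\<Sum>xs\<in>words D (k - 1). (if mset xs = mset ys then 1 else 0) * ?g xs)"
      using * overlap_cov_1[OF assms, of \<phi> "\<lambda>A. if A = mset ys then 1 else 0"] by simp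
    also have "\<dots> = (\<Sum>xs\<in>words D (k - 1). (if mset xs = mset ys then 1 else 0) * ?g ys)"
    proof (intro sum.cong refl)
      fix xs
      show "(if mset xs = mset ys then 1 else 0) * ?g xs = (if mset xs = mset ys then 1 else 0) * ?g ys"
      proof (cases "mset xs = mset ys")
        case True
        show ?thesis by (simp only: g[OF True])
      qed (simp only: if_False mult_zero_left)
    qed
    also have "\<dots> = real (card {xs \<in> words D (k - 1). mset xs = mset ys}) * ?g ys"
    proof -
      have "(\<Sum>xs\<in>words D (k - 1). (if mset xs = mset ys then 1 else 0) * c)
          = real (card {xs \<in> words D (k - 1). mset xs = mset ys}) * c" for c :: real
        using finite_D by (subst sum_distrib_right[symmetric]) (simp add: sum.If_cases Int_def)
      then show ?thesis .
    qed
    finally have "card {xs \<in> words D (k - 1). mset xs = mset ys} = 0 \<or> ?g ys = 0" by simp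
    moreover have "card {xs \<in> words D (k - 1). mset xs = mset ys} \<noteq> 0"
      using ys finite_D by (auto simp: card_eq_0_iff)
    ultimately show "?g ys = 0" by blast
  qed
qed (unfold overlap_cov_1[OF assms] degenerate_def, simp)

lemma degenerate_cong:
  assumes "k \<ge> 1" "\<And>A. set_mset A \<subseteq> D \<Longrightarrow> size A = k \<Longrightarrow> \<phi> A = \<psi> A"
  shows "degenerate k \<phi> \<longleftrightarrow> degenerate k \<psi>"
proof -
  have "(\<Sum>x\<in>D. law (x # xs) * \<phi> (mset (x # xs))) = (\<Sum>x\<in>D. law (x # xs) * \<psi> (mset (x # xs)))"
    if "xs \<in> words D (k - 1)" for xs
    using that assms by (intro sum.cong refl) (simp add: words_def)
  then show ?thesis by (simp add: degenerate_def)
qed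

section \<open>Conditional expectations reduced to finite sums\<close>

lemma degenerate_1_iff:
  "degenerate 1 \<phi> \<longleftrightarrow> (\<integral>\<omega>. \<phi> {#X 1 \<omega>#} \<partial>M) = 0"
proof -
  have "(\<integral>\<omega>. \<phi> (mset (sample [1] \<omega>)) \<partial>M) = (\<Sum>xs\<in>words D (Suc 0). law xs * \<phi> (mset xs))"
    by (rule expectation_sample) auto
  also have "\<dots> = (\<Sum>x\<in>D. law [x] * \<phi> {#x#})"
    by (simp add: sum_words_Suc)
  finally show ?thesis by (simp add: degenerate_def)
qed

text \<open>The sigma-algebra of coordinates 2 to \<open>k\<close> is finite, and its events are
  unions of the events that these coordinates form a given word. The conditional expectation
  vanishes almost surely exactly when the integral over each of these does.\<close>

lemma completely_degenerate_iff:
  assumes "k \<ge> 1" "symmetric_kernel D k \<kappa>"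
  shows "completely_degenerate M D X k \<kappa> \<longleftrightarrow> degenerate k (mset_kernel \<kappa>)"
proof (cases "k = 1")
  case True
  have "(\<integral>\<omega>. \<kappa> (subvec X {1..1} \<omega>) \<partial>M) = (\<integral>\<omega>. mset_kernel \<kappa> {#X 1 \<omega>#} \<partial>M)"
  proof (intro Bochner_Integration.integral_cong refl)
    fix \<omega> assume "\<omega> \<in> space M"
    then show "\<kappa> (subvec X {1..1} \<omega>) = mset_kernel \<kappa> {#X 1 \<omega>#}"
      using mset_kernel_eq[OF assms(2), of "[X 1 \<omega>]"] X_in_D[of 1 \<omega>] True by (simp add: subvec_def)
  qed
  then show ?thesis
    unfolding completely_degenerate_def True degenerate_1_iff by simp
next
  case False
  with assms have k: "k \<ge> 2" by simp
  define \<phi> where "\<phi> = mset_kernel \<kappa>"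
  let ?J = "{2..k}"
  let ?F = "sigma_gen M D X ?J"
  let ?P = "\<Pi>\<^sub>M i\<in>?J. count_space D"
  let ?X = "\<lambda>\<omega>. \<lambda>i\<in>?J. X i \<omega>"
  let ?f = "\<lambda>\<omega>. \<kappa> (subvec X {1..k} \<omega>)"
  let ?js = "[2..<Suc k]"
  have setsP: "sets ?P = Pow (?J \<rightarrow>\<^sub>E D)"
    using finite_D by (subst count_space_PiM_finite) (auto intro: countable_finite)
  have measX: "?X \<in> M \<rightarrow>\<^sub>M ?P" by (rule measurable_restrict, rule measurable_X) auto
  then have XP: "?X \<in> space M \<rightarrow> space ?P" by (rule measurable_space[THEN funcsetI])
  have setsF: "sets ?F = {?X -` A \<inter> space M | A. A \<in> sets ?P}"
    unfolding sigma_gen_def using XP by (rule sets_vimage_algebra2)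
  have "subalgebra M ?F"
    unfolding subalgebra_def setsF using measurable_sets[OF measX] by (auto simp: sigma_gen_def)
  then interpret F: finite_measure_subalgebra M ?F by unfold_locales
  have js: "distinct (1 # ?js)" "set (1 # ?js) \<subseteq> {1..}" "length ?js = k - 1" by auto
  then have len: "length (1 # ?js) = k" using assms(1) by (simp only: list.size)
  have f: "?f \<omega> = \<phi> (mset (sample (1 # ?js) \<omega>))" if "\<omega> \<in> space M" for \<omega>
  proof -
    have "sorted_list_of_set {1..k} = [1..<Suc k]"
      by (metis atLeastLessThanSuc_atLeastAtMost sorted_list_of_set_range)
    also have "\<dots> = 1 # ?js" using assms upt_conv_Cons[of 1 "Suc k"] by (simp del: upt_Suc add: numeral_2_eq_2)
    finally have *: "sorted_list_of_set {1..k} = 1 # ?js" .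
    have "sample (1 # ?js) \<omega> \<in> words D k"
      using sample_in_words[OF js(2) that] unfolding len .
    then have "mset_kernel \<kappa> (mset (sample (1 # ?js) \<omega>)) = \<kappa> (sample (1 # ?js) \<omega>)"
      unfolding words_def by (intro mset_kernel_eq[OF assms(2)]) blast+
    then show ?thesis unfolding subvec_def * \<phi>_def ..
  qed
  have intf: "integrable M ?f"
    using expectation_sample(1)[OF js(1,2) refl, of "\<lambda>xs. \<phi> (mset xs)"]
    by (subst Bochner_Integration.integrable_cong[OF refl f])
  have intA: "(\<integral>\<omega>. indicator B (sample ?js \<omega>) * ?f \<omega> \<partial>M)
      = (\<Sum>xs\<in>words D (k - 1). indicator B xs * (\<Sum>x\<in>D. law (x # xs) * \<phi> (mset (x # xs))))" for B
  proof -
    have "(\<integral>\<omega>. indicator B (sample ?js \<omega>) * ?f \<omega> \<partial>M)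
        = (\<integral>\<omega>. (\<lambda>xs. indicator B (tl xs) * \<phi> (mset xs)) (sample (1 # ?js) \<omega>) \<partial>M)"
      using f by (intro Bochner_Integration.integral_cong refl) (simp del: upt_Suc)
    also have "\<dots> = (\<Sum>xs\<in>words D (Suc (k - 1)). law xs * (indicator B (tl xs) * \<phi> (mset xs)))"
      by (subst expectation_sample(2)[OF js(1,2)]) (simp_all add: js(3) del: upt_Suc)
    also have "\<dots> = (\<Sum>xs\<in>words D (k - 1). indicator B xs * (\<Sum>x\<in>D. law (x # xs) * \<phi> (mset (x # xs))))"
      unfolding sum_words_Suc by (intro sum.cong refl) (simp add: sum_distrib_left mult_ac)
    finally show ?thesis .
  qed
  \<comment> \<open>Words and functions on \<open>{2..k}\<close> encode the same outcome; position 0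
    of the word belongs to index 2, whence the shift.\<close>
  let ?enc = "\<lambda>xs. \<lambda>i\<in>?J. xs ! (i - 2)"
  have enc_sample: "?enc (sample ?js \<omega>) = ?X \<omega>" for \<omega>
  proof (rule restrict_ext)
    fix i assume i: "i \<in> ?J"
    then have "?js ! (i - 2) = i" by (subst nth_upt) auto
    then show "sample ?js \<omega> ! (i - 2) = X i \<omega>" using i by (subst nth_map) auto
  qed
  have dec_enc: "map (?enc xs) ?js = xs" if "length xs = k - 1" for xs
  proof (rule nth_equalityI)
    fix i assume "i < length (map (?enc xs) ?js)"
    then have "i < k - 1" by (simp del: upt_Suc)
    then show "map (?enc xs) ?js ! i = xs ! i" by (auto simp del: upt_Suc)
  qed (use that in \<open>simp del: upt_Suc\<close>)
  show ?thesis
    unfolding \<phi>_def[symmetric]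
  proof
    assume "degenerate k \<phi>"
    have "AE \<omega> in M. real_cond_exp M ?F ?f \<omega> = (\<lambda>_. 0) \<omega>"
    proof (rule F.real_cond_exp_charact)
      fix A assume "A \<in> sets ?F"
      then obtain B where B: "A = ?X -` B \<inter> space M" using setsF by auto
      define B' where "B' = {xs. ?enc xs \<in> B}"
      have "indicator A \<omega> = (indicator B' (sample ?js \<omega>) :: real)" if "\<omega> \<in> space M" for \<omega>
        using that B enc_sample by (simp add: B'_def indicator_def del: upt_Suc)
      then have "(LINT \<omega>:A|M. ?f \<omega>) = (\<integral>\<omega>. indicator B' (sample ?js \<omega>) * ?f \<omega> \<partial>M)"
        unfolding set_lebesgue_integral_def by (intro Bochner_Integration.integral_cong refl) (simp del: upt_Suc)
      also have "\<dots> = 0" using \<open>degenerate k \<phi>\<close> unfolding intA by (simp add: degenerate_def)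
      finally show "(LINT \<omega>:A|M. ?f \<omega>) = (LINT \<omega>:A|M. 0)" by simp
    qed (use intf in auto)
    then show "completely_degenerate M D X k \<kappa>"
      using False by (simp add: completely_degenerate_def)
  next
    assume "completely_degenerate M D X k \<kappa>"
    then have AE: "AE \<omega> in M. real_cond_exp M ?F ?f \<omega> = 0"
      using False by (simp add: completely_degenerate_def)
    show "degenerate k \<phi>"
      unfolding degenerate_def
    proof
      fix xs assume xs: "xs \<in> words D (k - 1)"
      \<comment> \<open>Integrating over the event of a single word isolates the sum for
        \<open>xs\<close>, and the integral does not change when \<open>?f\<close> is replaced by
        its conditional expectation.\<close>
      define A where "A = {\<omega> \<in> space M. sample ?js \<omega> = xs}"
      have "A = ?X -` {?enc xs} \<inter> space M"
      proof -
        have "sample ?js \<omega> = xs \<longleftrightarrow> ?X \<omega> = ?enc xs" for \<omega>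
        proof
          assume "sample ?js \<omega> = xs"
          then show "?X \<omega> = ?enc xs" using enc_sample[of \<omega>] by (simp only:)
        next
          assume *: "?X \<omega> = ?enc xs"
          have "sample ?js \<omega> = map (?enc (sample ?js \<omega>)) ?js"
            by (rule dec_enc[symmetric]) (simp only: length_map js(3))
          also have "\<dots> = map (?enc xs) ?js" by (simp only: enc_sample *)
          also have "\<dots> = xs" by (rule dec_enc) (use xs in \<open>simp add: words_def\<close>)
          finally show "sample ?js \<omega> = xs" .
        qed
        then show ?thesis by (auto simp: A_def simp del: upt_Suc)
      qed
      moreover have "{?enc xs} \<in> sets ?P"
      proof -
        have "xs ! (i - 2) \<in> D" if "i \<in> ?J" for i
          using xs that nth_mem[of "i - 2" xs] by (auto simp: words_def)
        then show ?thesis unfolding setsP by auto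
      qed
      ultimately have A: "A \<in> sets ?F" using setsF by blast
      have "(\<Sum>x\<in>D. law (x # xs) * \<phi> (mset (x # xs)))
          = (\<integral>\<omega>. indicator {xs} (sample ?js \<omega>) * ?f \<omega> \<partial>M)"
        unfolding intA using xs finite_D
        by (subst sum.remove[of _ xs]) (auto intro!: sum.neutral)
      also have "\<dots> = (LINT \<omega>:A|M. ?f \<omega>)"
        unfolding set_lebesgue_integral_def
        by (intro Bochner_Integration.integral_cong refl) (auto simp: A_def indicator_def simp del: upt_Suc)
      also have "\<dots> = (LINT \<omega>:A|M. real_cond_exp M ?F ?f \<omega>)"
        by (rule F.real_cond_exp_intA[OF intf A])
      also have "\<dots> = (LINT \<omega>:A|M. 0)"
        unfolding set_lebesgue_integral_def using AE
        by (intro integral_cong_AE borel_measurable_scaleR) (use A F.subalg in \<open>auto simp: subalgebra_def\<close>)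
      finally show "(\<Sum>x\<in>D. law (x # xs) * \<phi> (mset (x # xs))) = 0" by simp
    qed
  qed
qed

text \<open>\<open>u\<close> is the number of indices that only \<open>\<phi>\<close> reads, up to
  disjointness at \<open>u = k\<close>. The value 1 is left out because it expresses degeneracy
  itself, which leaves no condition for \<open>k = 1\<close>.\<close>

definition weakly_independent :: bool where
  "weakly_independent \<longleftrightarrow> (\<forall>k\<ge>2. \<forall>u\<in>{2..k}. \<forall>\<phi> \<psi>. degenerate k \<phi> \<longrightarrow> overlap_cov k u \<phi> \<psi> = 0)"

section \<open>Projection onto degenerate kernels and orthogonality of U-statistics\<close>

lemma expectation_prefix:
  "(\<integral>\<omega>. f (sample [1..<Suc n] \<omega>) \<partial>M) = (\<Sum>xs\<in>words D n. law xs * f xs)"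
  by (rule expectation_sample) auto

lemma ustat_sample: "ustat (\<lambda>i. sample [1..<Suc n] \<omega> ! (i - 1)) {1..n} k \<phi> = ustat (\<lambda>i. X i \<omega>) {1..n} k \<phi>"
  unfolding ustat_def
proof (intro sum.cong refl arg_cong[of _ _ \<phi>] image_mset_cong)
  fix J i assume J: "J \<in> {J. J \<subseteq> {1..n} \<and> card J = k}" and i: "i \<in># mset_set J"
  then have "finite J" by (auto intro: finite_subset)
  then have "i \<in> {1..n}" using J i by auto
  then show "sample [1..<Suc n] \<omega> ! (i - 1) = X i \<omega>" by (cases i) (simp_all del: upt_Suc)
qed

text \<open>With only \<open>k\<close> variables, \<open>J\<close> is the full index set and each of
  the \<open>k\<close> sets \<open>I\<close> misses one index, so every pair has overlap
  \<open>k - 1\<close>. Degeneracy thereby becomes orthogonality to the range of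
  \<open>raise\<close>.\<close>

lemma expectation_raise:
  assumes "k \<ge> 1"
  shows "(\<Sum>xs\<in>words D k. law xs * (\<phi> (mset xs) * raise \<psi> (mset xs))) = k * overlap_cov k 1 \<phi> \<psi>"
proof -
  let ?Is = "{I. I \<subseteq> {1..k} \<and> card I = k - 1}"
  have full: "ustat (\<lambda>i. X i \<omega>) {1..k} k \<phi> = \<phi> (mset (sample [1..<Suc k] \<omega>))" for \<omega> and \<phi> :: "'a multiset \<Rightarrow> real"
    using ustat_full[of "{1..k}" "\<lambda>i. X i \<omega>" \<phi>] by (simp add: atLeastLessThanSuc_atLeastAtMost del: upt_Suc)
  have "ustat (\<lambda>i. X i \<omega>) {1..k} (k - 1) \<psi> = raise \<psi> (mset (sample [1..<Suc k] \<omega>))" for \<omega>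
    using ustat_raise[of "{1..k}" "k - 1" "\<lambda>i. X i \<omega>" \<psi>] assms unfolding full[symmetric]
    by (simp add: of_nat_diff del: upt_Suc)
  then have "(\<Sum>xs\<in>words D k. law xs * (\<phi> (mset xs) * raise \<psi> (mset xs)))
      = (\<integral>\<omega>. ustat (\<lambda>i. X i \<omega>) {1..k} k \<phi> * ustat (\<lambda>i. X i \<omega>) {1..k} (k - 1) \<psi> \<partial>M)"
    unfolding full using expectation_prefix[of "\<lambda>xs. \<phi> (mset xs) * raise \<psi> (mset xs)" k] by (simp del: upt_Suc)
  also have "\<dots> = (\<Sum>J\<in>{{1..k}}. \<Sum>I\<in>?Is. overlap_cov k (k - card (J \<inter> I)) \<phi> \<psi>)"
    unfolding expectation_ustat_product[OF assms]
    by (intro sum.cong refl) (auto dest: card_subset_eq[rotated])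
  also have "\<dots> = (\<Sum>I\<in>?Is. overlap_cov k 1 \<phi> \<psi>)"
    using assms by (auto intro!: sum.cong simp: Int_absorb1)
  also have "\<dots> = k * overlap_cov k 1 \<phi> \<psi>"
    using n_subsets[of "{1..k}" "k - 1"] binomial_symmetric[of "k - 1" k] assms by simp
  finally show ?thesis .
qed

text \<open>\<open>raise \<psi>\<close> is the orthogonal projection of \<open>\<phi>\<close> onto
  the range of \<open>raise\<close>; by \<open>expectation_raise\<close> the remainder is
  degenerate.\<close>

lemma degenerate_decomposition:
  assumes "k \<ge> 1"
  obtains \<psi> where "degenerate k (\<lambda>A. \<phi> A - raise \<psi> A)"
proof -
  let ?\<delta> = "\<lambda>B A. if A = B then 1 else 0 :: real"
  let ?I = "mset ` words D (k - 1)"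
  obtain c where c: "\<forall>B\<in>?I. (\<Sum>xs\<in>words D k. law xs *
      (\<phi> (mset xs) - (\<Sum>B\<in>?I. c B * raise (?\<delta> B) (mset xs))) * raise (?\<delta> B) (mset xs)) = 0"
    using weighted_projection[of "words D k" law ?I "\<lambda>xs. \<phi> (mset xs)" "\<lambda>B xs. raise (?\<delta> B) (mset xs)"]
      finite_D law_pos by auto
  define \<phi>' where "\<phi>' A = \<phi> A - raise c A" for A
  have \<delta>: "(\<Sum>xs\<in>words D k. law xs * (\<phi>' (mset xs) * raise (?\<delta> B) (mset xs))) = 0" if "B \<in> ?I" for B
  proof -
    have "(\<Sum>xs\<in>words D k. law xs * (\<phi>' (mset xs) * raise (?\<delta> B) (mset xs)))
        = (\<Sum>xs\<in>words D k. law xs *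
            (\<phi> (mset xs) - (\<Sum>B\<in>?I. c B * raise (?\<delta> B) (mset xs))) * raise (?\<delta> B) (mset xs))"
    proof (intro sum.cong refl)
      fix xs assume "xs \<in> words D k"
      show "law xs * (\<phi>' (mset xs) * raise (?\<delta> B) (mset xs)) = law xs *
            (\<phi> (mset xs) - (\<Sum>B\<in>?I. c B * raise (?\<delta> B) (mset xs))) * raise (?\<delta> B) (mset xs)"
        unfolding \<phi>'_def raise_delta_expansion[OF finite_D assms imageI[OF \<open>xs \<in> words D k\<close>], of c]
        by (simp only: mult.assoc)
    qed
    then show ?thesis using c that by (simp only:)
  qed
  have "k * overlap_cov k 1 \<phi>' \<psi> = 0" for \<psi>
  proof -
    have "k * overlap_cov k 1 \<phi>' \<psi>
        = (\<Sum>xs\<in>words D k. \<Sum>B\<in>?I. \<psi> B * (law xs * (\<phi>' (mset xs) * raise (?\<delta> B) (mset xs))))"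
      unfolding expectation_raise[OF assms, symmetric]
      using raise_delta_expansion[OF finite_D assms imageI, of _ \<psi>]
      by (intro sum.cong refl) (simp add: sum_distrib_left mult_ac)
    also have "\<dots> = (\<Sum>B\<in>?I. \<psi> B * (\<Sum>xs\<in>words D k. law xs * (\<phi>' (mset xs) * raise (?\<delta> B) (mset xs))))"
      by (subst sum.swap) (simp add: sum_distrib_left)
    finally show ?thesis using \<delta> by simp
  qed
  then have "degenerate k \<phi>'" using assms by (simp add: degenerate_iff_overlap_cov)
  then show ?thesis using that by (simp add: \<phi>'_def[abs_def])
qed

text \<open>Constants are the U-statistics of order 0, the empty index set contributing a single
  term. This lets \<open>k = 1\<close>, where orthogonality is against order 0, follow the general
  pattern.\<close>

lemma SU_eq: "SU D X n k = {U_stat X n k \<psi> | \<psi>. symmetric_kernel D k \<psi>}"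
proof (cases "k = 0")
  case True
  have 0: "{J. J \<subseteq> {1..n} \<and> card J = 0} = {{}}" by (auto dest: finite_subset)
  have U: "U_stat X n 0 \<psi> = (\<lambda>\<omega>. \<psi> [])" for \<psi>
    unfolding U_stat_def 0 by (simp add: subvec_def)
  have "(\<lambda>\<omega>. c) \<in> {U_stat X n 0 \<psi> | \<psi>. symmetric_kernel D 0 \<psi>}" for c
    using U[of "\<lambda>_. c", symmetric] by (force simp: symmetric_kernel_def)
  then show ?thesis using True U by (auto simp: SU_def)
qed (simp add: SU_def)

lemma U_stat_in_SH_iff:
  assumes "1 \<le> k" "k \<le> n" "symmetric_kernel D k \<kappa>"
  shows "U_stat X n k \<kappa> \<in> SH M D X n k \<longleftrightarrow>
    (\<forall>\<psi>. (\<integral>\<omega>. ustat (\<lambda>i. X i \<omega>) {1..n} k (mset_kernel \<kappa>) * ustat (\<lambda>i. X i \<omega>) {1..n} (k - 1) \<psi> \<partial>M) = 0)"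
    (is "_ \<longleftrightarrow> (\<forall>\<psi>. ?E \<psi> = 0)")
proof -
  note ustat_eq = U_stat_eq_ustat[where X = X and \<omega> = \<omega> and n = n for \<omega>]
  have in_D: "X i \<omega> \<in> D" if "\<omega> \<in> space M" "i \<in> {1..n}" for i \<omega>
    using that X_in_D by simp
  have eq: "(\<integral>\<omega>. U_stat X n k \<kappa> \<omega> * U_stat X n (k - 1) \<psi> \<omega> \<partial>M) = ?E (mset_kernel \<psi>)"
    if "symmetric_kernel D (k - 1) \<psi>" for \<psi>
    by (intro Bochner_Integration.integral_cong refl)
       (simp only: ustat_eq[OF assms(3) in_D] ustat_eq[OF that in_D])
  have eq': "?E \<psi> = (\<integral>\<omega>. U_stat X n k \<kappa> \<omega> * U_stat X n (k - 1) (\<lambda>xs. \<psi> (mset xs)) \<omega> \<partial>M)" for \<psi>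
    unfolding U_stat_mset
    by (intro Bochner_Integration.integral_cong refl) (simp only: ustat_eq[OF assms(3) in_D])
  have "U_stat X n k \<kappa> \<in> SU D X n k" using assms(3) by (auto simp: SU_eq)
  then have "U_stat X n k \<kappa> \<in> SH M D X n k \<longleftrightarrow>
      (\<forall>G\<in>SU D X n (k - 1). (\<integral>\<omega>. U_stat X n k \<kappa> \<omega> * G \<omega> \<partial>M) = 0)"
    using assms(1) U_stat_in_Ls[OF assms(3,2), of X] by (simp add: SH_def Ls_orthogonal_def)
  also have "\<dots> \<longleftrightarrow> (\<forall>\<psi>. ?E \<psi> = 0)"
  proof safe
    fix \<psi> assume "\<forall>G\<in>SU D X n (k - 1). (\<integral>\<omega>. U_stat X n k \<kappa> \<omega> * G \<omega> \<partial>M) = 0"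
    moreover have "U_stat X n (k - 1) (\<lambda>xs. \<psi> (mset xs)) \<in> SU D X n (k - 1)"
      unfolding SU_eq using symmetric_kernel_mset by blast
    ultimately show "?E \<psi> = 0" unfolding eq' by (rule bspec)
  next
    fix G assume "\<forall>\<psi>. ?E \<psi> = 0" "G \<in> SU D X n (k - 1)"
    then show "(\<integral>\<omega>. U_stat X n k \<kappa> \<omega> * G \<omega> \<partial>M) = 0"
      unfolding SU_eq by (auto simp only: eq)
  qed
  finally show ?thesis .
qed

lemma degenerate_imp_orthogonal:
  assumes "weakly_independent" "1 \<le> k" "degenerate k \<phi>"
  shows "(\<integral>\<omega>. ustat (\<lambda>i. X i \<omega>) {1..n} k \<phi> * ustat (\<lambda>i. X i \<omega>) {1..n} (k - 1) \<psi> \<partial>M) = 0"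
proof -
  have "overlap_cov k u \<phi> \<psi> = 0" if "1 \<le> u" "u \<le> k" for u
  proof (cases "u = 1")
    case True
    then show ?thesis using assms by (simp add: degenerate_iff_overlap_cov)
  next
    case False
    then show ?thesis using assms that by (auto simp: weakly_independent_def)
  qed
  moreover have "1 \<le> k - card (J \<inter> I)" if "I \<subseteq> {1..n}" "card I = k - 1" for I J
  proof -
    have "card (J \<inter> I) \<le> card I" using that by (intro card_mono) (auto intro: finite_subset)
    then show ?thesis using assms(2) that by simp
  qed
  ultimately show ?thesis
    unfolding expectation_ustat_product[OF assms(2)] by (intro sum.neutral ballI) auto
qed

lemma orthogonal_imp_degenerate:
  assumes "weakly_independent" "1 \<le> k" "k \<le> n"
    and orth: "\<And>\<psi>. (\<integral>\<omega>. ustat (\<lambda>i. X i \<omega>) {1..n} k \<phi> * ustat (\<lambda>i. X i \<omega>) {1..n} (k - 1) \<psi> \<partial>M) = 0"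
  shows "degenerate k \<phi>"
proof -
  obtain c where c: "degenerate k (\<lambda>A. \<phi> A - raise c A)"
    using degenerate_decomposition[OF assms(2)] by blast
  let ?U = "\<lambda>\<omega>. ustat (\<lambda>i. X i \<omega>) {1..n}"
  let ?S = "\<lambda>xs. ustat (\<lambda>i. xs ! (i - 1)) {1..n}"
  have E: "(\<integral>\<omega>. ?U \<omega> k \<phi> * ?U \<omega> l \<psi> \<partial>M) = (\<Sum>xs\<in>words D n. law xs * (?S xs k \<phi> * ?S xs l \<psi>))" for l k \<phi> \<psi>
    using expectation_prefix[of "\<lambda>xs. ?S xs k \<phi> * ?S xs l \<psi>" n] by (simp only: ustat_sample)
  have S: "?S xs k (\<lambda>A. \<phi> A - raise c A) = ?S xs k \<phi> - real (n - (k - 1)) * ?S xs (k - 1) c" for xs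
    using ustat_raise[of "{1..n}" "k - 1" "\<lambda>i. xs ! (i - 1)" c] assms(2,3)
    by (simp add: ustat_def sum_subtractf)
  \<comment> \<open>Testing against \<open>c\<close> itself turns two vanishing inner products into
    the squared norm of the U-statistic of \<open>c\<close>. The factor \<open>n - (k - 1)\<close>
    comes from \<open>ustat_raise\<close> and is positive since \<open>k\<close> is at most
    \<open>n\<close>.\<close>
  have "(\<Sum>xs\<in>words D n. law xs * (real (n - (k - 1)) * (?S xs (k - 1) c * ?S xs (k - 1) c)))
      = (\<Sum>xs\<in>words D n. law xs * (?S xs k \<phi> * ?S xs (k - 1) c))
      - (\<Sum>xs\<in>words D n. law xs * (?S xs k (\<lambda>A. \<phi> A - raise c A) * ?S xs (k - 1) c))"
    unfolding sum_subtractf[symmetric] S by (intro sum.cong refl) (simp only: algebra_simps)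
  then have "(\<Sum>xs\<in>words D n. law xs * (real (n - (k - 1)) * (?S xs (k - 1) c * ?S xs (k - 1) c))) = 0"
    using orth[of c] degenerate_imp_orthogonal[OF assms(1,2) c, of n c] unfolding E by simp
  moreover have "0 \<le> law xs" for xs by (simp add: law_def)
  ultimately have *: "\<forall>xs\<in>words D n. law xs * (real (n - (k - 1)) * (?S xs (k - 1) c * ?S xs (k - 1) c)) = 0"
    using finite_D by (subst (asm) sum_nonneg_eq_0_iff) auto
  have "?S xs (k - 1) c = 0" if "xs \<in> words D n" for xs
  proof -
    have "law xs \<noteq> 0" using law_pos[OF that] by simp
    moreover have "real (n - (k - 1)) \<noteq> 0" using assms(2,3) by simp
    ultimately show ?thesis using *[rule_format, OF that] by (simp only: mult_eq_0_iff) auto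
  qed
  moreover obtain e where "e \<in> D" using X_in_D[of 1] not_empty by auto
  ultimately have c0: "c B = 0" if "set_mset B \<subseteq> D" "size B = k - 1" for B
    using ustat_eq_0_imp[of e D "k - 1" n c B] that assms(3) by auto
  have "raise c A = 0" if "set_mset A \<subseteq> D" "size A = k" for A
  proof -
    have "raise c A = raise (\<lambda>_. 0) A"
      using that by (intro raise_cong c0) (auto simp: size_Diff_singleton dest: in_diffD)
    then show ?thesis by (simp add: raise_def)
  qed
  then show ?thesis using c degenerate_cong[OF assms(2), of \<phi> "\<lambda>A. \<phi> A - raise c A"] by simp
qed

lemma orthogonal_imp_weakly_independent:
  assumes orth: "\<And>n k \<phi> \<psi>. n \<ge> 2 \<Longrightarrow> 2 \<le> k \<Longrightarrow> k \<le> n \<Longrightarrow> degenerate k \<phi> \<Longrightarrow>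
      (\<integral>\<omega>. ustat (\<lambda>i. X i \<omega>) {1..n} k \<phi> * ustat (\<lambda>i. X i \<omega>) {1..n} (k - 1) \<psi> \<partial>M) = 0"
  shows weakly_independent
proof -
  have "overlap_cov k u \<phi> \<psi> = 0" if k: "2 \<le> k" and deg: "degenerate k \<phi>" and u: "1 \<le> u" "u \<le> k" for k u \<phi> \<psi>
    using u
  proof (induction u rule: less_induct)
    case (less u)
    \<comment> \<open>The smallest sample in which index sets of sizes \<open>k\<close> and
      \<open>k - 1\<close> can share only \<open>k - u\<close> indices: their union has at most
      \<open>?n\<close> elements, so no pair overlaps less, and larger overlaps fall under the
      induction hypothesis.\<close>
    let ?n = "k + u - 1"
    let ?P = "\<lambda>k. {J. J \<subseteq> {1..?n} \<and> card J = k}"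
    let ?Q = "{(J, I) \<in> ?P k \<times> ?P (k - 1). k - card (J \<inter> I) = u}"
    show ?case
    proof (cases "u = 1")
      case True
      then show ?thesis using deg k by (simp add: degenerate_iff_overlap_cov)
    next
      case False
      have le: "1 \<le> k - card (J \<inter> I) \<and> k - card (J \<inter> I) \<le> u" if "J \<in> ?P k" "I \<in> ?P (k - 1)" for J I
      proof -
        have fin: "finite J" "finite I" using that by (auto intro: finite_subset)
        have "card (J \<union> I) \<le> card {1..?n}" using that by (intro card_mono) auto
        moreover have "card (J \<union> I) + card (J \<inter> I) = card J + card I"
          using card_Un_Int[OF fin] by simp
        moreover have "card (J \<inter> I) \<le> card I" using fin by (intro card_mono) auto
        ultimately show ?thesis using that k by auto
      qed
      have "0 = (\<Sum>J\<in>?P k. \<Sum>I\<in>?P (k - 1). overlap_cov k (k - card (J \<inter> I)) \<phi> \<psi>)"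
        using orth[of ?n k \<phi> \<psi>] expectation_ustat_product[of k ?n \<phi> \<psi>] k deg less.prems by simp
      also have "\<dots> = (\<Sum>(J, I)\<in>?P k \<times> ?P (k - 1). overlap_cov k (k - card (J \<inter> I)) \<phi> \<psi>)"
        by (rule sum.cartesian_product)
      also have "\<dots> = (\<Sum>(J, I)\<in>?Q. overlap_cov k u \<phi> \<psi>)"
      proof (rule sum.mono_neutral_cong_right)
        show "\<forall>x\<in>?P k \<times> ?P (k - 1) - ?Q. (case x of (J, I) \<Rightarrow> overlap_cov k (k - card (J \<inter> I)) \<phi> \<psi>) = 0"
        proof
          fix x assume x: "x \<in> ?P k \<times> ?P (k - 1) - ?Q"
          obtain J I where JI: "x = (J, I)" by (cases x)
          then have "J \<in> ?P k" "I \<in> ?P (k - 1)" and "k - card (J \<inter> I) \<noteq> u" using x by auto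
          then have "overlap_cov k (k - card (J \<inter> I)) \<phi> \<psi> = 0"
            using le less.IH less.prems by (meson le_neq_implies_less le_trans less_imp_le)
          then show "(case x of (J, I) \<Rightarrow> overlap_cov k (k - card (J \<inter> I)) \<phi> \<psi>) = 0" using JI by simp
        qed
      qed auto
      also have "\<dots> = real (card ?Q) * overlap_cov k u \<phi> \<psi>" by (simp add: case_prod_unfold)
      finally have "card ?Q = 0 \<or> overlap_cov k u \<phi> \<psi> = 0" by simp
      moreover have "({1..k}, {u + 1..?n}) \<in> ?Q"
      proof -
        have "{1..k} \<inter> {u + 1..?n} = {u + 1..k}" using less.prems by auto
        then show ?thesis using less.prems k by auto
      qed
      moreover have "finite ?Q" by (rule finite_subset[of _ "?P k \<times> ?P (k - 1)"]) auto
      ultimately show ?thesis by (metis (no_types, lifting) card_0_eq empty_iff)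
    qed
  qed
  then show ?thesis unfolding weakly_independent_def by auto
qed

theorem hoeffding_decomposable_iff_weakly_independent:
  "hoeffding_decomposable M D X \<longleftrightarrow> weakly_independent"
proof
  assume HD: "hoeffding_decomposable M D X"
  show weakly_independent
  proof (rule orthogonal_imp_weakly_independent)
    fix n k :: nat and \<phi> \<psi> :: "'a multiset \<Rightarrow> real"
    assume *: "n \<ge> 2" "2 \<le> k" "k \<le> n" "degenerate k \<phi>"
    define \<kappa> where "\<kappa> = (\<lambda>xs. \<phi> (mset xs))"
    have sym: "symmetric_kernel D k \<kappa>" unfolding \<kappa>_def by (rule symmetric_kernel_mset)
    have \<kappa>: "mset_kernel \<kappa> = \<phi>"
    proof
      fix A :: "'a multiset"
      have "mset (SOME xs. mset xs = A) = A" using ex_mset by (rule someI_ex)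
      then show "mset_kernel \<kappa> A = \<phi> A" by (simp add: mset_kernel_def \<kappa>_def)
    qed
    have k: "1 \<le> k" "k \<in> {1..n}" using * by auto
    have "U_stat X n k \<kappa> \<in> SH M D X n k \<longleftrightarrow> completely_degenerate M D X k \<kappa>"
      using HD *(1) k(2) sym unfolding hoeffding_decomposable_def by blast
    then show "(\<integral>\<omega>. ustat (\<lambda>i. X i \<omega>) {1..n} k \<phi> * ustat (\<lambda>i. X i \<omega>) {1..n} (k - 1) \<psi> \<partial>M) = 0"
      unfolding U_stat_in_SH_iff[OF k(1) *(3) sym] completely_degenerate_iff[OF k(1) sym] \<kappa>
      using *(4) by blast
  qed
next
  assume W: weakly_independent
  show "hoeffding_decomposable M D X"
    unfolding hoeffding_decomposable_def
  proof (intro allI ballI impI)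
    fix n k \<kappa> assume "k \<in> {1..n}" and sym: "symmetric_kernel D k \<kappa>"
    then have k: "1 \<le> k" "k \<le> n" by auto
    show "U_stat X n k \<kappa> \<in> SH M D X n k \<longleftrightarrow> completely_degenerate M D X k \<kappa>"
      unfolding U_stat_in_SH_iff[OF k sym] completely_degenerate_iff[OF k(1) sym]
      using degenerate_imp_orthogonal[OF W k(1)] orthogonal_imp_degenerate[OF W k] by blast
  qed
qed

end

section \<open>Starred multinomial coefficients\<close>

text \<open>The hypothesis is sharp: at \<open>a = -1\<close>, \<open>b = 0\<close> the left side is
  1 and the right side 0.\<close>

lemma binom_star_pascal:
  assumes "0 \<le> a"
  shows "binom_star (a + 1) b = binom_star a b + binom_star a (b - 1)"
proof (cases "b \<ge> 1")
  case True
  obtain i where i: "a = int i" using assms by (metis nonneg_eq_int)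
  obtain j where "nat b = Suc j" using True by (cases "nat b") auto
  then have j: "b = int (Suc j)" by linarith
  have "nat (a + 1) = Suc i" "nat (b - 1) = j" "nat b = Suc j" "nat a = i" using i j by auto
  then show ?thesis using i j by (auto simp: binom_star_def binomial_eq_0)
qed (use assms in \<open>auto simp: binom_star_def\<close>)

lemma multinom_star_Suc:
  "multinom_star m (Suc r) b = multinom_star m r b * binom_star (m - (\<Sum>p=1..r. b p)) (b (Suc r))"
  by (simp add: multinom_star_def atLeastLessThanSuc_atLeastAtMost)

lemma multinom_star_cong:
  assumes "\<And>i. i \<in> {1..r} \<Longrightarrow> b i = c i"
  shows "multinom_star m r b = multinom_star m r c"
  unfolding multinom_star_def
proof (rule prod.cong[OF refl])
  fix j assume j: "j \<in> {1..r}"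
  then have "(\<Sum>p=1..<j. b p) = (\<Sum>p=1..<j. c p)" using assms by (intro sum.cong) auto
  then show "binom_star (m - (\<Sum>p=1..<j. b p)) (b j) = binom_star (m - (\<Sum>p=1..<j. c p)) (c j)"
    using assms[OF j] by simp
qed

text \<open>At the first index where the partial sums exceed \<open>m\<close>, the entry is larger
  than what remains, so that factor is 0.\<close>

lemma multinom_star_eq_0:
  assumes "0 \<le> m" "m < (\<Sum>p=1..r. b p)"
  shows "multinom_star m r b = 0"
  using assms
proof (induction r)
  case (Suc r)
  then show ?case
    by (cases "m < (\<Sum>p=1..r. b p)") (auto simp: multinom_star_Suc binom_star_def)
qed simp

text \<open>For nonnegative \<open>m\<close>, \<open>multinom_star m r b\<close> is the coefficient
  of the monomial with exponents \<open>b\<close> in the \<open>m\<close>-th power of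
  \<open>1 + t\<^sub>1 + ... + t\<^sub>r\<close>; one factor is split off.\<close>

lemma multinom_star_pascal:
  assumes "0 \<le> m"
  shows "multinom_star (m + 1) r b = multinom_star m r b + (\<Sum>p=1..r. multinom_star m r (b(p := b p - 1)))"
proof (induction r)
  case 0
  then show ?case by (simp add: multinom_star_def)
next
  case (Suc r)
  let ?s = "\<Sum>p=1..r. b p"
  have upd: "multinom_star m (Suc r) (b(p := b p - 1))
      = multinom_star m r (b(p := b p - 1)) * binom_star (m + 1 - ?s) (b (Suc r))" if "p \<in> {1..r}" for p
  proof -
    have "(\<Sum>q=1..r. (b(p := b p - 1)) q) = (\<Sum>q=1..r. b q + (if q = p then -1 else 0))"
      by (intro sum.cong) auto
    also have "\<dots> = ?s - 1" using that by (simp add: sum.distrib)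
    finally have *: "(\<Sum>q=1..r. (b(p := b p - 1)) q) = ?s - 1" .
    show ?thesis
      unfolding multinom_star_Suc * using that by (simp add: algebra_simps del: fun_upd_apply) (simp add: fun_upd_apply)
  qed
  have last: "multinom_star m (Suc r) (b(Suc r := b (Suc r) - 1))
      = multinom_star m r b * binom_star (m - ?s) (b (Suc r) - 1)"
    unfolding multinom_star_Suc
    by (subst multinom_star_cong[of r "b(Suc r := b (Suc r) - 1)" b]) auto
  \<comment> \<open>Pascal's rule may fail when the remaining upper entry is negative, but then the
    first factor already vanishes.\<close>
  have *: "multinom_star m r b * binom_star (m + 1 - ?s) (b (Suc r))
      = multinom_star m r b * (binom_star (m - ?s) (b (Suc r)) + binom_star (m - ?s) (b (Suc r) - 1))"
  proof (cases "m < ?s")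
    case True
    then show ?thesis using multinom_star_eq_0[OF assms True] by simp
  next
    case False
    then show ?thesis using binom_star_pascal[of "m - ?s" "b (Suc r)"] by (simp add: algebra_simps)
  qed
  show ?case
  proof -
    have "(\<Sum>p=1..Suc r. multinom_star m (Suc r) (b(p := b p - 1)))
        = (\<Sum>p=1..r. multinom_star m r (b(p := b p - 1))) * binom_star (m + 1 - ?s) (b (Suc r))
          + multinom_star m r b * binom_star (m - ?s) (b (Suc r) - 1)"
      using upd last by (simp add: sum_distrib_right del: fun_upd_apply)
    moreover have "multinom_star (m + 1) (Suc r) b
        = multinom_star m r b * binom_star (m + 1 - ?s) (b (Suc r))
          + (\<Sum>p=1..r. multinom_star m r (b(p := b p - 1))) * binom_star (m + 1 - ?s) (b (Suc r))"
      by (simp only: multinom_star_Suc Suc.IH distrib_right)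
    moreover have "multinom_star m (Suc r) b = multinom_star m r b * binom_star (m - ?s) (b (Suc r))"
      by (rule multinom_star_Suc)
    ultimately show ?thesis using * by (simp only: distrib_left)
  qed
qed

lemma multinom_star_0: "multinom_star 0 r b = (if \<forall>i\<in>{1..r}. b i = 0 then 1 else 0)"
proof (induction r)
  case (Suc r)
  have all: "(\<forall>i\<in>{1..Suc r}. b i = 0) \<longleftrightarrow> (\<forall>i\<in>{1..r}. b i = 0) \<and> b (Suc r) = 0"
    by (auto simp: le_Suc_eq)
  show ?case
  proof (cases "\<forall>i\<in>{1..r}. b i = 0")
    case True
    then have "(\<Sum>p=1..r. b p) = 0" by simp
    then show ?thesis unfolding multinom_star_Suc all Suc.IH using True by (simp add: binom_star_def)
  next
    case False
    then show ?thesis unfolding multinom_star_Suc all Suc.IH by (simp only: if_False simp_thms mult_zero_left)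
  qed
qed (simp add: multinom_star_def)

section \<open>Words with prescribed letter counts\<close>

locale enumerated_set =
  fixes D :: "'a set" and d :: "nat \<Rightarrow> 'a" and K :: nat
  assumes bij_d: "bij_betw d {1..K} D" and K_ge: "K \<ge> 3"
begin

abbreviation bounded_vectors :: "nat \<Rightarrow> nat \<Rightarrow> (nat \<Rightarrow> nat) set" where
  "bounded_vectors n r \<equiv> \<Union>a\<in>{0..n}. weak_compositions a r"

text \<open>The count of \<open>d K\<close> is omitted because the size determines it; restricting
  to \<open>{1..K-1}\<close> puts the vector into the extensional index sets over which the theorem
  sums.\<close>

definition letter_counts :: "'a multiset \<Rightarrow> nat \<Rightarrow> nat" where
  "letter_counts A = (\<lambda>p\<in>{1..K-1}. count A (d p))"

lemma finite_enumerated: "finite D"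
  using bij_betw_finite[OF bij_d] by simp

lemma d_eq_iff: "p \<in> {1..K} \<Longrightarrow> q \<in> {1..K} \<Longrightarrow> d p = d q \<longleftrightarrow> p = q"
  using bij_betw_imp_inj_on[OF bij_d] by (rule inj_on_eq_iff)

lemma d_in_D: "p \<in> {1..K} \<Longrightarrow> d p \<in> D"
  using bij_betwE[OF bij_d] by blast

lemma sum_D: "(\<Sum>x\<in>D. f x) = (\<Sum>p=1..K. f (d p))"
  by (rule sum.reindex_bij_betw[OF bij_d, symmetric])

lemma prod_D: "(\<Prod>x\<in>D. f x) = (\<Prod>p=1..K. f (d p))"
  by (rule prod.reindex_bij_betw[OF bij_d, symmetric])

lemma split_last: "{1..K} = insert K {1..K-1}" "K \<notin> {1..K-1}"
  using K_ge by auto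

lemma size_eq_sum_counts:
  assumes "set_mset A \<subseteq> D"
  shows "size A = (\<Sum>p=1..K-1. count A (d p)) + count A (d K)"
proof -
  have "size A = (\<Sum>x\<in>D. count A x)"
    unfolding size_multiset_overloaded_eq using assms finite_enumerated
    by (intro sum.mono_neutral_left) (auto simp: not_in_iff)
  then show ?thesis unfolding sum_D split_last(1) using split_last(2) by simp
qed

lemma mset_eqI_counts:
  assumes "set_mset A \<subseteq> D" "set_mset B \<subseteq> D" "size A = size B"
    "\<And>p. p \<in> {1..K-1} \<Longrightarrow> count A (d p) = count B (d p)"
  shows "A = B"
proof (rule multiset_eqI)
  fix x
  have "count A (d K) = count B (d K)"
    using size_eq_sum_counts[OF assms(1)] size_eq_sum_counts[OF assms(2)] assms(3,4) by simp
  then have "count A (d p) = count B (d p)" if "p \<in> {1..K}" for p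
    using that assms(4) by (cases "p = K") auto
  moreover have "count A x = count B x" if "x \<notin> D"
  proof -
    have "x \<notin># A" "x \<notin># B" using that assms(1,2) by auto
    then show ?thesis by (simp add: not_in_iff)
  qed
  moreover have "x \<in> D \<Longrightarrow> \<exists>p\<in>{1..K}. x = d p" using bij_d by (auto simp: bij_betw_def)
  ultimately show "count A x = count B x" by blast
qed

text \<open>Size and these counts determine a multiset \<open>A\<close> whose rearrangements are the
  words in question; the count \<open>r\<close> of the last letter supplies the implicit factor of
  \<open>multinom\<close>.\<close>

lemma card_words_letter_counts:
  assumes "k \<in> bounded_vectors n (K - 1)"
  shows "real (card {b \<in> words D n. letter_counts (mset b) = k}) = multinom n (K - 1) k"
proof -
  have ext: "k \<in> {1..K-1} \<rightarrow>\<^sub>E UNIV" and le: "(\<Sum>p=1..K-1. k p) \<le> n"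
    using assms by (auto simp: weak_compositions_def)
  define r where "r = n - (\<Sum>p=1..K-1. k p)"
  define A where "A = (\<Sum>p\<in>{1..K-1}. replicate_mset (k p) (d p)) + replicate_mset r (d K)"
  have cnt: "count A (d p) = (if p = K then r else k p)" if "p \<in> {1..K}" for p
  proof -
    have "count A (d p) = (\<Sum>q\<in>{1..K-1}. if q = p then k q else 0) + (if p = K then r else 0)"
      unfolding A_def count_union count_sum
      using that K_ge by (intro arg_cong2[of _ _ _ _ "(+)"] sum.cong) (auto simp: d_eq_iff)
    then show ?thesis using that by auto
  qed
  have sub: "set_mset A \<subseteq> D"
    using K_ge by (auto simp: A_def set_mset_sum intro!: d_in_D split: if_splits)
  have size: "size A = n"
  proof -
    have "(\<Sum>p=1..K-1. count A (d p)) = (\<Sum>p=1..K-1. k p)" using cnt by (intro sum.cong) auto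
    then show ?thesis using size_eq_sum_counts[OF sub] cnt[of K] le K_ge by (simp add: r_def)
  qed
  have "letter_counts (mset b) = k \<longleftrightarrow> mset b = A" if "b \<in> words D n" for b
  proof
    assume *: "letter_counts (mset b) = k"
    show "mset b = A"
    proof (rule mset_eqI_counts)
      fix p assume "p \<in> {1..K-1}"
      then show "count (mset b) (d p) = count A (d p)"
        using cnt[of p] fun_cong[OF *, of p] by (auto simp: letter_counts_def)
    qed (use that sub size in \<open>auto simp: words_def\<close>)
  next
    assume "mset b = A"
    then show "letter_counts (mset b) = k"
      using cnt ext by (auto simp: letter_counts_def fun_eq_iff PiE_iff extensional_def)
  qed
  moreover have "b \<in> words D n" if "mset b = A" for b
    using that sub size by (auto simp: words_def)
  ultimately have "{b \<in> words D n. letter_counts (mset b) = k} = permutations_of_multiset A"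
    by (auto simp: permutations_of_multiset_def)
  moreover have "real (card (permutations_of_multiset A)) * (\<Prod>x\<in>set_mset A. fact (count A x)) = fact n"
    using arg_cong[OF card_permutations_of_multiset_aux[of A], of real] size by simp
  moreover have "(\<Prod>x\<in>set_mset A. fact (count A x)) = (\<Prod>p=1..K-1. fact (k p)) * (fact r :: real)"
  proof -
    have "(\<Prod>x\<in>set_mset A. fact (count A x)) = (\<Prod>x\<in>D. fact (count A x) :: real)"
      using sub finite_enumerated by (intro prod.mono_neutral_left) (auto simp: not_in_iff)
    also have "\<dots> = (\<Prod>p=1..K. fact (if p = K then r else k p))"
      unfolding prod_D using cnt by (intro prod.cong) auto
    also have "\<dots> = (\<Prod>p=1..K-1. fact (k p)) * fact r"
      unfolding split_last(1) using split_last(2) by (auto intro!: prod.cong)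
    finally show ?thesis .
  qed
  ultimately show ?thesis
    by (simp add: multinom_def r_def field_simps)
qed

section \<open>Sums over words grouped by letter counts; coherent vectors\<close>

lemma letter_counts_bounded:
  assumes "b \<in> words D n"
  shows "letter_counts (mset b) \<in> bounded_vectors n (K - 1)"
  using assms size_eq_sum_counts[of "mset b"]
  by (auto simp: weak_compositions_def letter_counts_def words_def)

lemma finite_bounded_vectors: "finite (bounded_vectors n r)"
proof (rule finite_subset)
  show "bounded_vectors n r \<subseteq> {1..r} \<rightarrow>\<^sub>E {0..n}"
  proof
    fix v assume v: "v \<in> bounded_vectors n r"
    have "v j \<le> n" if "j \<in> {1..r}" for j
      using v that member_le_sum[of j "{1..r}" v] by (auto simp: weak_compositions_def)
    then show "v \<in> {1..r} \<rightarrow>\<^sub>E {0..n}" using v by (auto simp: weak_compositions_def PiE_iff)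
  qed
qed (simp add: finite_PiE)

text \<open>\<open>C\<close> need only contain the counts at which \<open>F\<close> contributes, so
  that one lemma yields sums over all bounded vectors and sums over coherent ones.\<close>

lemma sum_words_by_letter_counts:
  fixes F :: "(nat \<Rightarrow> nat) \<Rightarrow> real"
  assumes "C \<subseteq> bounded_vectors n (K - 1)"
    and "\<And>b. b \<in> words D n \<Longrightarrow> letter_counts (mset b) \<notin> C \<Longrightarrow> F (letter_counts (mset b)) = 0"
  shows "(\<Sum>b\<in>words D n. F (letter_counts (mset b))) = (\<Sum>k\<in>C. multinom n (K - 1) k * F k)"
proof -
  let ?S = "{b \<in> words D n. letter_counts (mset b) \<in> C}"
  have "(\<Sum>b\<in>words D n. F (letter_counts (mset b))) = (\<Sum>b\<in>?S. F (letter_counts (mset b)))"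
    using assms(2) finite_enumerated by (intro sum.mono_neutral_right) auto
  also have "\<dots> = (\<Sum>k\<in>C. \<Sum>b\<in>{b \<in> ?S. letter_counts (mset b) = k}. F (letter_counts (mset b)))"
    using finite_subset[OF assms(1) finite_bounded_vectors] finite_enumerated
    by (intro sum.group[symmetric]) auto
  also have "\<dots> = (\<Sum>k\<in>C. \<Sum>b\<in>{b \<in> words D n. letter_counts (mset b) = k}. F k)"
    by (intro sum.cong) auto
  also have "\<dots> = (\<Sum>k\<in>C. multinom n (K - 1) k * F k)"
  proof (intro sum.cong refl)
    fix k assume "k \<in> C"
    then have "k \<in> bounded_vectors n (K - 1)" using assms(1) by blast
    then show "(\<Sum>b\<in>{b \<in> words D n. letter_counts (mset b) = k}. F k) = multinom n (K - 1) k * F k"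
      by (simp add: card_words_letter_counts)
  qed
  finally show ?thesis .
qed

text \<open>Coherence is weaker than being the counts of a part of \<open>z\<close>; the superfluous coherent vectors
  are harmless because the conditional probability vanishes on them.\<close>

lemma coherent_vectors_bounded:
  assumes "u \<le> n"
  shows "coherent_vectors K n u z \<subseteq> bounded_vectors (n - u) (K - 1)"
proof
  fix k assume k: "k \<in> coherent_vectors K n u z"
  have "K - 1 \<in> {1..K-1}" using K_ge by auto
  then have "int (k (K-1)) \<le> int n - int u - (\<Sum>p=1..<K-1. int (k p))"
    using k by (auto simp: coherent_vectors_def)
  moreover have "{1..K-1} = insert (K-1) {1..<K-1}" using K_ge by auto
  then have "(\<Sum>p=1..K-1. k p) = k (K-1) + (\<Sum>p=1..<K-1. k p)" by simp
  ultimately have "(\<Sum>p=1..K-1. k p) \<le> n - u" using assms by (simp flip: of_nat_sum)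
  then show "k \<in> bounded_vectors (n - u) (K - 1)"
    using k by (auto simp: coherent_vectors_def weak_compositions_def)
qed

lemma sum_counts_le_size:
  assumes "j \<in> {1..K-1}"
  shows "(\<Sum>p=1..j. count A (d p)) \<le> size A"
proof -
  have "(\<Sum>p=1..j. count A (d p)) = (\<Sum>x\<in>d ` {1..j}. count A x)"
    using assms by (intro sum.reindex_cong[of d, symmetric]) (auto simp: inj_on_def d_eq_iff)
  also have "\<dots> \<le> (\<Sum>x\<in>d ` {1..j} \<union> set_mset A. count A x)"
    by (intro sum_mono2) auto
  also have "\<dots> = size A"
    unfolding size_multiset_overloaded_eq by (intro sum.mono_neutral_right) (auto simp: not_in_iff)
  finally show ?thesis .
qed

text \<open>The upper bounds say that \<open>b\<close> uses no letter more often than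
  \<open>z\<close> allows and has only \<open>n - u\<close> letters. The lower bound says that the
  letters of \<open>c\<close> among the first \<open>j\<close> kinds number at most
  \<open>u - 1\<close>.\<close>

lemma letter_counts_coherent:
  assumes "2 \<le> u" "u \<le> n" "b \<in> words D (n - u)" "c \<in> words D (u - 1)"
    and z: "\<And>p. p \<in> {1..K-1} \<Longrightarrow> count (mset b + mset c) (d p) = z p"
  shows "letter_counts (mset b) \<in> coherent_vectors K n u z"
  unfolding coherent_vectors_def
proof (intro CollectI conjI ballI)
  fix j assume j: "j \<in> {1..K-1}"
  let ?b = "\<lambda>p. count (mset b) (d p)"
  let ?c = "\<lambda>p. count (mset c) (d p)"
  have split: "{1..j} = insert j {1..<j}" using j by auto
  have "(\<Sum>p=1..<j. ?b p) + ?b j \<le> n - u" "(\<Sum>p=1..<j. ?c p) + ?c j \<le> u - 1"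
    using sum_counts_le_size[OF j, of "mset b"] sum_counts_le_size[OF j, of "mset c"] assms(3,4)
    unfolding split by (simp_all add: words_def)
  then have le: "(\<Sum>p=1..<j. int (?b p)) + int (?b j) \<le> int n - int u"
    "(\<Sum>p=1..<j. int (?c p)) + int (?c j) \<le> int u - 1"
    using assms(1,2) by (simp_all flip: of_nat_sum of_nat_add)
  have k: "letter_counts (mset b) p = ?b p" "z p = ?b p + ?c p" if "p \<in> {1..j}" for p
    using that j z[of p] by (auto simp: letter_counts_def)
  have "(\<Sum>p=1..<j. int (letter_counts (mset b) p)) = (\<Sum>p=1..<j. int (?b p))"
    using k by (intro sum.cong) auto
  moreover have "(\<Sum>p=1..<j. int (z p) - int (letter_counts (mset b) p)) = (\<Sum>p=1..<j. int (?c p))"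
    using k by (intro sum.cong) auto
  moreover have "0 \<le> (\<Sum>p=1..<j. int (?c p))" by (intro sum_nonneg) simp
  ultimately show "int (letter_counts (mset b) j) \<in>
      {max 0 (int (z j) - (int u - 1) - (\<Sum>p=1..<j. int (z p) - int (letter_counts (mset b) p)))
       .. min (int (z j)) (int n - int u - (\<Sum>p=1..<j. int (letter_counts (mset b) p)))}"
    using le k[of j] j by auto
qed (simp add: letter_counts_def)

end

section \<open>The combinatorial characterization\<close>

context enumerated_set
begin

text \<open>These kernels are the coefficients in \<open>t\<close> of the \<open>n\<close>-th tensor power of the vector
  \<open>(-(1 + t\<^sub>1 + \<dots> + t\<^bsub>K-2\<^esub>), t\<^sub>1, \<dots>, t\<^bsub>K-2\<^esub>, 1)\<close>, whose entries sum to 0.\<close>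

definition null_kernel :: "(nat \<Rightarrow> nat) \<Rightarrow> 'a multiset \<Rightarrow> real" where
  "null_kernel m A = (-1) ^ count A (d 1) *
     multinom_star (int (count A (d 1))) (K - 2) (\<lambda>i. int (m i) - int (count A (d (i + 1))))"

lemma sum_split_ends:
  fixes f :: "nat \<Rightarrow> 'b::comm_monoid_add"
  shows "(\<Sum>p=1..K-1. f p) = f 1 + (\<Sum>i=1..K-2. f (i + 1))"
proof -
  have "{1..K-1} = insert 1 (Suc ` {1..K-2})"
    using K_ge by (auto simp: image_Suc_atLeastAtMost)
  moreover have "(\<Sum>p\<in>Suc ` {1..K-2}. f p) = (\<Sum>i=1..K-2. f (i + 1))"
    by (subst sum.reindex) (simp_all add: o_def del: image_Suc_atLeastAtMost)
  moreover have "1 \<notin> Suc ` {1..K-2}" by auto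
  ultimately show ?thesis by (simp del: image_Suc_atLeastAtMost)
qed

text \<open>Contracting one slot of a tensor power with the all-ones functional produces the entry
  sum of the vector, which is 0. In coefficients this is \<open>multinom_star_pascal\<close>:
  \<open>d 1\<close> contributes the left side negated, \<open>d K\<close> the unshifted term, and
  the other letters the shifted ones.\<close>

lemma null_kernel_sum: "(\<Sum>x\<in>D. null_kernel m (add_mset x A)) = 0"
proof -
  define a where "a = count A (d 1)"
  define b where "b = (\<lambda>i. int (m i) - int (count A (d (i + 1))))"
  have cnt: "count (add_mset (d p) A) (d q) = count A (d q) + (if p = q then 1 else 0)"
    if "p \<in> {1..K}" "q \<in> {1..K}" for p q
    using d_eq_iff[OF that] by auto
  have first: "null_kernel m (add_mset (d 1) A) = - ((-1) ^ a * multinom_star (int a + 1) (K - 2) b)"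
  proof -
    have "multinom_star (int a + 1) (K - 2) (\<lambda>i. int (m i) - int (count (add_mset (d 1) A) (d (i + 1))))
        = multinom_star (int a + 1) (K - 2) b"
    proof (rule multinom_star_cong)
      fix i assume i: "i \<in> {1..K-2}"
      then have "i + 1 \<in> {1..K}" "1 \<in> {1..K}" by auto
      then show "int (m i) - int (count (add_mset (d 1) A) (d (i + 1))) = b i"
        using cnt[of 1 "i + 1"] i by (simp add: b_def)
    qed
    then show ?thesis
      using cnt[of 1 1] K_ge by (simp add: null_kernel_def a_def algebra_simps)
  qed
  have other: "null_kernel m (add_mset (d p) A) = (-1) ^ a * multinom_star (int a) (K - 2) b'"
    if "p \<in> {2..K}" "\<And>i. i \<in> {1..K-2} \<Longrightarrow> b' i = b i - (if p = i + 1 then 1 else 0)" for p b'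
  proof -
    have "multinom_star (int a) (K - 2) (\<lambda>i. int (m i) - int (count (add_mset (d p) A) (d (i + 1))))
        = multinom_star (int a) (K - 2) b'"
    proof (rule multinom_star_cong)
      fix i assume i: "i \<in> {1..K-2}"
      have "i + 1 \<in> {1..K}" "p \<in> {1..K}" using i that(1) by auto
      then show "int (m i) - int (count (add_mset (d p) A) (d (i + 1))) = b' i"
        using cnt[of p "i + 1"] that(2)[OF i] by (simp add: b_def)
    qed
    moreover have "count (add_mset (d p) A) (d 1) = a"
      using cnt[of p 1] that(1) K_ge by (auto simp: a_def)
    ultimately show ?thesis by (simp add: null_kernel_def)
  qed
  have "null_kernel m (add_mset (d (i + 1)) A)
      = (-1) ^ a * multinom_star (int a) (K - 2) (b(i := b i - 1))" if "i \<in> {1..K-2}" for i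
    using that by (intro other) auto
  moreover have "null_kernel m (add_mset (d K) A) = (-1) ^ a * multinom_star (int a) (K - 2) b"
    using K_ge by (intro other) auto
  ultimately have "(\<Sum>p=1..K. null_kernel m (add_mset (d p) A))
      = - ((-1) ^ a * multinom_star (int a + 1) (K - 2) b)
        + (\<Sum>i=1..K-2. (-1) ^ a * multinom_star (int a) (K - 2) (b(i := b i - 1)))
        + (-1) ^ a * multinom_star (int a) (K - 2) b"
    unfolding split_last(1) using split_last(2) first
    by (subst sum.insert) (simp_all add: sum_split_ends[simplified] add_ac)
  also have "\<dots> = 0"
    by (simp add: multinom_star_pascal distrib_left sum_distrib_left del: fun_upd_apply)
  finally show ?thesis unfolding sum_D .
qed

text \<open>Without \<open>d 1\<close> there is no factor to expand and a single monomial in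
  \<open>t\<close> remains. Hence the kernels are dual to the multisets avoiding
  \<open>d 1\<close>.\<close>

lemma null_kernel_delta:
  assumes "count A (d 1) = 0"
  shows "null_kernel m A = (if \<forall>i\<in>{1..K-2}. m i = count A (d (i + 1)) then 1 else 0)"
  using assms by (simp add: null_kernel_def multinom_star_0)

lemma null_kernel_cong:
  assumes "\<And>p. p \<in> {1..K-1} \<Longrightarrow> count A (d p) = c p"
  shows "null_kernel m A = (-1) ^ c 1 *
     multinom_star (int (c 1)) (K - 2) (\<lambda>i. int (m i) - int (c (i + 1)))"
proof -
  have "multinom_star (int (c 1)) (K - 2) (\<lambda>i. int (m i) - int (count A (d (i + 1))))
      = multinom_star (int (c 1)) (K - 2) (\<lambda>i. int (m i) - int (c (i + 1)))"
    using assms by (intro multinom_star_cong) auto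
  then show ?thesis using assms[of 1] K_ge by (simp add: null_kernel_def)
qed

text \<open>Each \<open>d 1\<close> can be traded away: the zero letter sum writes the value at
  \<open>A\<close> as minus the sum of the values at the multisets with one \<open>d 1\<close>
  replaced by another letter.\<close>

lemma null_function_eq_0:
  assumes null: "\<And>B. set_mset B \<subseteq> D \<Longrightarrow> Suc (size B) = n \<Longrightarrow> (\<Sum>x\<in>D. g (add_mset x B)) = (0::real)"
    and zero: "\<And>B. set_mset B \<subseteq> D \<Longrightarrow> size B = n \<Longrightarrow> count B (d 1) = 0 \<Longrightarrow> g B = 0"
    and "set_mset A \<subseteq> D" "size A = n"
  shows "g A = 0"
  using assms(3,4)
proof (induction "count A (d 1)" arbitrary: A)
  case 0
  then show ?case using zero by metis
next
  case (Suc c)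
  then have "d 1 \<in># A" by (metis count_eq_zero_iff nat.distinct(1))
  then obtain B where B: "A = add_mset (d 1) B" by (blast dest: multi_member_split)
  have d1: "d 1 \<in> D" using K_ge by (intro d_in_D) auto
  have "g (add_mset x B) = 0" if "x \<in> D - {d 1}" for x
    using that Suc.prems Suc.hyps(2) unfolding B by (intro Suc.hyps(1)) auto
  then have "(\<Sum>x\<in>D. g (add_mset x B)) = g A"
    using d1 finite_enumerated B by (subst sum.remove[of _ "d 1"]) auto
  then show ?case using null[of B] Suc.prems B by auto
qed

lemma null_function_expansion:
  assumes "n \<ge> 1"
    and null: "\<And>B. set_mset B \<subseteq> D \<Longrightarrow> Suc (size B) = n \<Longrightarrow> (\<Sum>x\<in>D. g (add_mset x B)) = (0::real)"
  obtains c where "\<And>A. set_mset A \<subseteq> D \<Longrightarrow> size A = n \<Longrightarrow>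
    g A = (\<Sum>m\<in>bounded_vectors n (K - 2). c m * null_kernel m A)"
proof -
  let ?T = "bounded_vectors n (K - 2)"
  define P where "P m A \<longleftrightarrow> set_mset A \<subseteq> D \<and> size A = n \<and> count A (d 1) = 0 \<and>
    (\<forall>i\<in>{1..K-2}. m i = count A (d (i + 1)))" for m :: "nat \<Rightarrow> nat" and A
  \<comment> \<open>The coefficients are the values of \<open>g\<close> on multisets avoiding
    \<open>d 1\<close>, where the kernels are dual to points; agreement there forces agreement
    everywhere by \<open>null_function_eq_0\<close>.\<close>
  define c where "c m = g (SOME A. P m A)" for m
  define g' where "g' A = g A - (\<Sum>m\<in>?T. c m * null_kernel m A)" for A
  have "g' A = 0" if "set_mset A \<subseteq> D" "size A = n" for A
  proof (rule null_function_eq_0[OF _ _ that])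
    fix B assume "set_mset B \<subseteq> D" "Suc (size B) = n"
    moreover have "(\<Sum>x\<in>D. \<Sum>m\<in>?T. c m * null_kernel m (add_mset x B)) = 0"
      by (subst sum.swap) (simp add: sum_distrib_left[symmetric] null_kernel_sum)
    ultimately show "(\<Sum>x\<in>D. g' (add_mset x B)) = 0"
      by (simp add: g'_def sum_subtractf null)
  next
    fix B assume B: "set_mset B \<subseteq> D" "size B = n" "count B (d 1) = 0"
    define m where "m = (\<lambda>i\<in>{1..K-2}. count B (d (i + 1)))"
    have "P m B" using B by (simp add: P_def m_def)
    moreover have "A = B" if "P m A" for A
    proof (rule mset_eqI_counts)
      fix p assume p: "p \<in> {1..K-1}"
      show "count A (d p) = count B (d p)"
      proof (cases "p = 1")
        case False
        then have "p - 1 \<in> {1..K-2}" "p - 1 + 1 = p" using p by auto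
        then show ?thesis using that unfolding P_def m_def by (metis restrict_apply')
      qed (use that B in \<open>simp add: P_def\<close>)
    qed (use that B in \<open>auto simp: P_def\<close>)
    ultimately have "(SOME A. P m A) = B" by blast
    then have cm: "c m = g B" by (simp add: c_def)
    have "(\<Sum>i=1..K-2. m i) = (\<Sum>i=1..K-2. count B (d (i + 1)))" by (simp add: m_def)
    also have "\<dots> \<le> n" using size_eq_sum_counts[OF B(1)] B(2) by (simp add: sum_split_ends[simplified])
    finally have mT: "m \<in> ?T" by (auto simp: weak_compositions_def m_def)
    have "null_kernel m' B = (if m' = m then 1 else 0)" if "m' \<in> ?T" for m'
    proof -
      have "m' \<in> {1..K-2} \<rightarrow>\<^sub>E UNIV" using that by (auto simp: weak_compositions_def)
      then have "(\<forall>i\<in>{1..K-2}. m' i = count B (d (i + 1))) \<longleftrightarrow> m' = m"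
        by (auto simp: m_def PiE_iff extensional_def fun_eq_iff)
      then show ?thesis using null_kernel_delta[OF B(3), of m'] by simp
    qed
    then have "(\<Sum>m\<in>?T. c m * null_kernel m B) = (\<Sum>m'\<in>?T. if m' = m then c m' else 0)"
      by (intro sum.cong) auto
    also have "\<dots> = c m" using mT finite_bounded_vectors[where n = n and r = "K - 2"] by simp
    finally show "g' B = 0" by (simp add: g'_def cm)
  qed
  then show ?thesis using that[of c] by (simp add: g'_def)
qed

definition count_indicator :: "(nat \<Rightarrow> nat) \<Rightarrow> 'a multiset \<Rightarrow> real" where
  "count_indicator z A = (if \<forall>p\<in>{1..K-1}. count A (d p) = z p then 1 else 0)"

text \<open>The first \<open>K - 1\<close> counts single out one multiset of size \<open>n\<close>,
  so on that size the indicators are those of points and the coefficients are the values of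
  \<open>\<psi>\<close>.\<close>

lemma count_indicator_expansion:
  obtains c where "\<And>A. set_mset A \<subseteq> D \<Longrightarrow> size A = n \<Longrightarrow>
    \<psi> A = (\<Sum>z\<in>weak_compositions n K. c z * count_indicator z A)"
proof -
  let ?T = "weak_compositions n K"
  define P where "P z A \<longleftrightarrow> set_mset A \<subseteq> D \<and> size A = n \<and> (\<forall>p\<in>{1..K-1}. count A (d p) = z p)"
    for z :: "nat \<Rightarrow> nat" and A
  define c where "c z = \<psi> (SOME A. P z A)" for z
  have fin: "finite ?T" by (rule finite_subset[OF _ finite_bounded_vectors[where n = n and r = K]]) auto
  have sumK: "(\<Sum>p=1..K. f p) = (\<Sum>p=1..K-1. f p) + f K" for f :: "nat \<Rightarrow> nat"
    unfolding split_last(1) using split_last(2) by simp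
  have "\<psi> A = (\<Sum>z\<in>?T. c z * count_indicator z A)" if A: "set_mset A \<subseteq> D" "size A = n" for A
  proof -
    define z where "z = (\<lambda>p\<in>{1..K}. count A (d p))"
    have z: "z \<in> ?T"
    proof -
      have "(\<Sum>p=1..K. z p) = (\<Sum>p=1..K. count A (d p))" by (simp add: z_def)
      also have "\<dots> = n" using size_eq_sum_counts[OF A(1)] A(2) unfolding sumK by (simp only:)
      finally have "(\<Sum>p=1..K. z p) = n" .
      moreover have "z \<in> {1..K} \<rightarrow>\<^sub>E UNIV" by (simp add: z_def)
      ultimately show ?thesis by (simp only: weak_compositions_def mem_Collect_eq)
    qed
    have zp: "z p = count A (d p)" if "p \<in> {1..K-1}" for p
    proof -
      have "p \<in> {1..K}" using that by auto
      then show ?thesis unfolding z_def by (rule restrict_apply')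
    qed
    then have "P z A" using A by (simp add: P_def)
    moreover have "B = A" if "P z B" for B
      using that \<open>P z A\<close> by (intro mset_eqI_counts) (auto simp: P_def)
    ultimately have "(SOME A. P z A) = A" by blast
    then have cz: "c z = \<psi> A" by (simp add: c_def)
    have "count_indicator z' A = (if z' = z then 1 else 0)" if z': "z' \<in> ?T" for z'
    proof -
      have "z' = z" if *: "\<forall>p\<in>{1..K-1}. count A (d p) = z' p"
      proof
        fix p
        have eq: "z' p = z p" if "p \<in> {1..K-1}" for p using * that zp by simp
        then have "(\<Sum>p=1..K-1. z' p) = (\<Sum>p=1..K-1. z p)" by (intro sum.cong) auto
        then have "z' K = z K" using z z' unfolding weak_compositions_def by (simp add: sumK[simplified])
        then have "z' p = z p" if "p \<in> {1..K}" using that eq split_last(1) by (cases "p = K") auto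
        moreover have "z' p = z p" if "p \<notin> {1..K}"
          using that z z' by (auto simp: weak_compositions_def PiE_iff extensional_def)
        ultimately show "z' p = z p" by blast
      qed
      then have "(\<forall>p\<in>{1..K-1}. count A (d p) = z' p) \<longleftrightarrow> z' = z" using zp by auto
      then show ?thesis by (simp only: count_indicator_def)
    qed
    then have "(\<Sum>z\<in>?T. c z * count_indicator z A) = (\<Sum>z'\<in>?T. if z' = z then c z' else 0)"
      by (intro sum.cong) auto
    also have "\<dots> = \<psi> A" using z fin cz by simp
    finally show ?thesis ..
  qed
  then show ?thesis by (rule that)
qed

end

section \<open>From overlap covariances to the displayed sums\<close>

locale enumerated_exchangeable = positive_exchangeable M D X + enumerated_set D d K
  for M :: "'w measure" and D :: "'a set" and X d K
begin

lemma prob_prefix: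
  "prob {\<omega> \<in> space M. Q (sample [1..<Suc n] \<omega>)} = (\<Sum>xs\<in>words D n. law xs * (if Q xs then 1 else 0))"
proof -
  let ?A = "{\<omega> \<in> space M. Q (sample [1..<Suc n] \<omega>)}"
  have "prob ?A = (\<integral>\<omega>. indicator ?A \<omega> \<partial>M)"
  proof -
    have "?A \<inter> space M = ?A" by auto
    then show ?thesis by (simp only: Bochner_Integration.integral_indicator)
  qed
  also have "\<dots> = (\<integral>\<omega>. (\<lambda>xs. if Q xs then 1 else 0) (sample [1..<Suc n] \<omega>) \<partial>M)"
    by (intro Bochner_Integration.integral_cong refl) (simp add: indicator_def del: upt_Suc)
  also have "\<dots> = (\<Sum>xs\<in>words D n. law xs * (if Q xs then 1 else 0))"
    by (rule expectation_prefix)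
  finally show ?thesis .
qed

definition has_letter_counts :: "(nat \<Rightarrow> nat) \<Rightarrow> 'a multiset \<Rightarrow> bool" where
  "has_letter_counts a A \<longleftrightarrow> (\<forall>p\<in>{1..K-1}. count A (d p) = a p)"

lemma has_counts_iff: "has_counts (K-1) d X n a \<omega> \<longleftrightarrow> has_letter_counts a (mset (sample [1..<Suc n] \<omega>))"
proof -
  have "card {i \<in> {1..n}. X i \<omega> = x} = count (mset (sample [1..<Suc n] \<omega>)) x" for x
  proof (induction n)
    case (Suc n)
    have "{i \<in> {1..Suc n}. X i \<omega> = x}
        = {i \<in> {1..n}. X i \<omega> = x} \<union> (if X (Suc n) \<omega> = x then {Suc n} else {})"
      by (auto simp: le_Suc_eq)
    then have "card {i \<in> {1..Suc n}. X i \<omega> = x}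
        = card {i \<in> {1..n}. X i \<omega> = x} + (if X (Suc n) \<omega> = x then 1 else 0)"
      by simp
    then show ?case using Suc.IH by simp
  qed simp
  then show ?thesis by (simp add: has_counts_def has_letter_counts_def del: upt_Suc)
qed

text \<open>All \<open>N\<close> words with counts \<open>b\<close> are rearrangements of
  \<open>w\<close> and have equal law, also after appending \<open>c\<close>. So \<open>N\<close>
  cancels, and conditioning on the counts is conditioning on the single word
  \<open>w\<close>.\<close>

lemma count_cond_prob_eq:
  assumes w: "w \<in> words D n" and b: "has_letter_counts b (mset w)"
  shows "count_cond_prob M K d X n (n + l) a b
    = (\<Sum>c\<in>words D l. law (w @ c) * (if has_letter_counts a (mset w + mset c) then 1 else 0)) / law w"
proof -
  let ?I = "\<lambda>Q. if Q then 1 else 0 :: real"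
  let ?S = "\<Sum>c\<in>words D l. law (w @ c) * ?I (has_letter_counts a (mset w + mset c))"
  define N where "N = (\<Sum>y\<in>words D n. ?I (has_letter_counts b (mset y)))"
  have same: "mset y = mset w" if "y \<in> words D n" "has_letter_counts b (mset y)" for y
    using that w b by (intro mset_eqI_counts) (auto simp: words_def has_letter_counts_def)
  have "N \<ge> ?I (has_letter_counts b (mset w))"
    unfolding N_def using w finite_D by (intro member_le_sum) auto
  then have N: "N \<noteq> 0" using b by auto
  have den: "prob {\<omega> \<in> space M. has_counts (K-1) d X n b \<omega>} = N * law w"
    unfolding has_counts_iff prob_prefix[where Q = "\<lambda>xs. has_letter_counts b (mset xs)"] N_def sum_distrib_right
  proof (intro sum.cong refl)
    fix y assume y: "y \<in> words D n"
    show "law y * ?I (has_letter_counts b (mset y)) = ?I (has_letter_counts b (mset y)) * law w"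
    proof (cases "has_letter_counts b (mset y)")
      case True
      show ?thesis using law_cong_mset[OF same[OF y True]] by simp
    qed simp
  qed
  have take: "sample [1..<Suc n] \<omega> = take n (sample [1..<Suc (n + l)] \<omega>)" for \<omega>
    by (simp add: take_map del: upt_Suc)
  have "prob {\<omega> \<in> space M. has_counts (K-1) d X (n + l) a \<omega> \<and> has_counts (K-1) d X n b \<omega>}
      = (\<Sum>xs\<in>words D (n + l). law xs * ?I (has_letter_counts a (mset xs) \<and> has_letter_counts b (mset (take n xs))))"
    unfolding has_counts_iff take
    by (rule prob_prefix[where Q = "\<lambda>xs. has_letter_counts a (mset xs) \<and> has_letter_counts b (mset (take n xs))"])
  also have "\<dots> = (\<Sum>y\<in>words D n. \<Sum>c\<in>words D l.
      law (y @ c) * ?I (has_letter_counts a (mset y + mset c) \<and> has_letter_counts b (mset y)))"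
    unfolding sum_words_append by (intro sum.cong refl) (simp add: words_def)
  also have "\<dots> = N * ?S"
    unfolding N_def sum_distrib_right
  proof (intro sum.cong refl)
    fix y assume y: "y \<in> words D n"
    show "(\<Sum>c\<in>words D l. law (y @ c) * ?I (has_letter_counts a (mset y + mset c) \<and> has_letter_counts b (mset y)))
        = ?I (has_letter_counts b (mset y)) * ?S"
    proof (cases "has_letter_counts b (mset y)")
      case True
      note eq = same[OF y True]
      have "law (y @ c) = law (w @ c)" for c by (rule law_cong_mset) (simp add: eq)
      then show ?thesis using True by (simp add: eq)
    qed simp
  qed
  finally show ?thesis
    unfolding count_cond_prob_def cond_prob_def den using N by simp
qed

text \<open>Degeneracy weights the letters by the law, whereas null kernels have plain zero sums;
  the quotient converts one into the other.\<close>

definition normalized_kernel :: "(nat \<Rightarrow> nat) \<Rightarrow> 'a multiset \<Rightarrow> real" where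
  "normalized_kernel m A = null_kernel m A / mset_kernel law A"

lemma mset_kernel_law: "mset_kernel law (mset xs) = law xs"
proof -
  have "mset (SOME ys. mset ys = mset xs) = mset xs" by (rule someI[of _ xs]) simp
  then show ?thesis unfolding mset_kernel_def by (rule law_cong_mset)
qed

lemma normalized_kernel_degenerate:
  assumes "n \<ge> 1"
  shows "degenerate n (normalized_kernel m)"
  unfolding degenerate_def
proof
  fix xs assume xs: "xs \<in> words D (n - 1)"
  have "(\<Sum>x\<in>D. law (x # xs) * normalized_kernel m (mset (x # xs))) = (\<Sum>x\<in>D. null_kernel m (add_mset x (mset xs)))"
  proof (intro sum.cong refl)
    fix x assume "x \<in> D"
    then have "law (x # xs) \<noteq> 0" using law_pos[of "x # xs" n] xs assms by (auto simp: words_def)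
    then show "law (x # xs) * normalized_kernel m (mset (x # xs)) = null_kernel m (add_mset x (mset xs))"
      unfolding normalized_kernel_def mset_kernel_law by simp
  qed
  then show "(\<Sum>x\<in>D. law (x # xs) * normalized_kernel m (mset (x # xs))) = 0"
    by (simp only: null_kernel_sum)
qed

lemma degenerate_expansion:
  assumes "n \<ge> 1" "degenerate n \<phi>"
  obtains c where "\<And>A. set_mset A \<subseteq> D \<Longrightarrow> size A = n \<Longrightarrow>
    \<phi> A = (\<Sum>m\<in>bounded_vectors n (K - 2). c m * normalized_kernel m A)"
proof -
  have null: "(\<Sum>x\<in>D. mset_kernel law (add_mset x B) * \<phi> (add_mset x B)) = 0"
    if B: "set_mset B \<subseteq> D" "Suc (size B) = n" for B
  proof -
    obtain xs where xs: "mset xs = B" using ex_mset by blast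
    then have "xs \<in> words D (n - 1)" using B by (auto simp: words_def)
    from bspec[OF assms(2)[unfolded degenerate_def] this]
    have "(\<Sum>x\<in>D. law (x # xs) * \<phi> (mset (x # xs))) = 0" .
    then show ?thesis by (simp only: mset_kernel_law[symmetric] mset.simps xs)
  qed
  obtain c where c: "\<And>A. set_mset A \<subseteq> D \<Longrightarrow> size A = n \<Longrightarrow>
      mset_kernel law A * \<phi> A = (\<Sum>m\<in>bounded_vectors n (K - 2). c m * null_kernel m A)"
    using null_function_expansion[where g = "\<lambda>A. mset_kernel law A * \<phi> A", OF assms(1) null] by blast
  have "\<phi> A = (\<Sum>m\<in>bounded_vectors n (K - 2). c m * normalized_kernel m A)"
    if A: "set_mset A \<subseteq> D" "size A = n" for A
  proof -
    obtain xs where xs: "mset xs = A" using ex_mset by blast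
    then have "xs \<in> words D n" using A by (auto simp: words_def)
    then have "law xs > 0" by (rule law_pos)
    then have "mset_kernel law A \<noteq> 0" using mset_kernel_law[of xs] unfolding xs by simp
    then have "\<phi> A = (mset_kernel law A * \<phi> A) / mset_kernel law A" by simp
    also have "\<dots> = (\<Sum>m\<in>bounded_vectors n (K - 2). c m * normalized_kernel m A)"
      unfolding c[OF A] by (simp add: sum_divide_distrib normalized_kernel_def)
    finally show ?thesis .
  qed
  then show ?thesis by (rule that)
qed

definition coherent_sum :: "nat \<Rightarrow> nat \<Rightarrow> (nat \<Rightarrow> nat) \<Rightarrow> (nat \<Rightarrow> nat) \<Rightarrow> real" where
  "coherent_sum n u z m = (\<Sum>k\<in>coherent_vectors K n u z.
     (-1) ^ k 1 * multinom (n-u) (K-1) k *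
     (\<Sum>q\<in>bounded_vectors u (K-1).
        (-1) ^ q 1 * multinom u (K-1) q *
        multinom_star (int (k 1 + q 1)) (K-2) (\<lambda>i. int (m i) - int (k (i+1)) - int (q (i+1))) *
        count_cond_prob M K d X n (n+u-1) (\<lambda>p. z p + q p) (\<lambda>p. k p + q p)))"

text \<open>A word of length \<open>n + u - 1\<close> is cut as \<open>a @ b @ c\<close> into
  \<open>u\<close> letters read by the kernel alone, \<open>n - u\<close> shared letters, and
  \<open>u - 1\<close> letters read by the indicator alone. The counts of \<open>a\<close> become
  \<open>q\<close> and those of \<open>b\<close> become \<open>k\<close>; the indicator asks for
  counts \<open>z\<close> in \<open>b @ c\<close>, that is, \<open>z + q\<close> in the whole
  word.\<close>

lemma overlap_cov_eq_coherent_sum: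
  assumes "2 \<le> u" "u \<le> n"
  shows "overlap_cov n u (normalized_kernel m) (count_indicator z) = coherent_sum n u z m"
proof -
  let ?H = "\<lambda>k q. (-1) ^ (k 1 + q 1) *
    multinom_star (int (k 1 + q 1)) (K-2) (\<lambda>i. int (m i) - int (k (i+1)) - int (q (i+1))) *
    count_cond_prob M K d X n (n+u-1) (\<lambda>p. z p + q p) (\<lambda>p. k p + q p)"
  let ?F = "\<lambda>k. \<Sum>q\<in>bounded_vectors u (K-1). multinom u (K-1) q * ?H k q"
  let ?lc = "\<lambda>a. letter_counts (mset a)"
  \<comment> \<open>Only \<open>c\<close> is summed out. The denominator of
    \<open>normalized_kernel\<close> is the law of \<open>a @ b\<close>, so the quotient is the
    conditional probability of \<open>count_cond_prob_eq\<close>.\<close>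
  have inner: "(\<Sum>c\<in>words D (u-1). law (a @ b @ c) *
        (normalized_kernel m (mset a + mset b) * count_indicator z (mset b + mset c)))
      = ?H (?lc b) (?lc a)"
    if a: "a \<in> words D u" and b: "b \<in> words D (n-u)" for a b
  proof -
    have lc: "?lc x p = count (mset x) (d p)" if "p \<in> {1..K-1}" for x p
      using that by (simp add: letter_counts_def)
    have ab: "a @ b \<in> words D n" using a b assms by (auto simp: words_def)
    have nn: "n + u - 1 = n + (u - 1)" using assms by simp
    have "has_letter_counts (\<lambda>p. ?lc b p + ?lc a p) (mset (a @ b))"
      by (simp add: has_letter_counts_def lc)
    note ccp = count_cond_prob_eq[OF ab this, of "u - 1" "\<lambda>p. z p + ?lc a p", folded nn]
    have ind: "(if has_letter_counts (\<lambda>p. z p + ?lc a p) (mset (a @ b) + mset c) then 1 else 0)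
        = count_indicator z (mset b + mset c)" for c
      by (auto simp: has_letter_counts_def count_indicator_def lc)
    have null: "null_kernel m (mset a + mset b) = (-1) ^ (?lc b 1 + ?lc a 1) *
        multinom_star (int (?lc b 1 + ?lc a 1)) (K-2)
          (\<lambda>i. int (m i) - int (?lc b (i+1)) - int (?lc a (i+1)))"
      by (subst null_kernel_cong[of _ "\<lambda>p. ?lc b p + ?lc a p"]) (auto simp: lc algebra_simps)
    have "(\<Sum>c\<in>words D (u-1). law (a @ b @ c) *
          (normalized_kernel m (mset a + mset b) * count_indicator z (mset b + mset c)))
        = null_kernel m (mset a + mset b) *
          ((\<Sum>c\<in>words D (u-1). law ((a @ b) @ c) * count_indicator z (mset b + mset c)) / law (a @ b))"
      using mset_kernel_law[of "a @ b"]
      by (simp add: normalized_kernel_def sum_distrib_left sum_divide_distrib mult_ac)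
    also have "\<dots> = null_kernel m (mset a + mset b) *
        count_cond_prob M K d X n (n+u-1) (\<lambda>p. z p + ?lc a p) (\<lambda>p. ?lc b p + ?lc a p)"
      unfolding ccp ind ..
    finally show ?thesis unfolding null .
  qed
  have "overlap_cov n u (normalized_kernel m) (count_indicator z)
      = (\<Sum>xs\<in>words D (u + ((n-u) + (u-1))). law xs *
          (normalized_kernel m (mset (take n xs)) * count_indicator z (mset (drop u xs))))"
  proof -
    have "u + ((n-u) + (u-1)) = n + u - 1" using assms by simp
    then show ?thesis by (simp only: overlap_cov_def)
  qed
  also have "\<dots> = (\<Sum>a\<in>words D u. \<Sum>b\<in>words D (n-u). \<Sum>c\<in>words D (u-1).
      law (a @ b @ c) * (normalized_kernel m (mset a + mset b) * count_indicator z (mset b + mset c)))"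
    unfolding sum_words_append using assms by (intro sum.cong refl) (auto simp: words_def)
  also have "\<dots> = (\<Sum>b\<in>words D (n-u). \<Sum>a\<in>words D u. ?H (?lc b) (?lc a))"
    by (subst sum.swap) (intro sum.cong refl inner)
  also have "\<dots> = (\<Sum>b\<in>words D (n-u). ?F (?lc b))"
    by (intro sum.cong refl sum_words_by_letter_counts) (auto dest: letter_counts_bounded)
  \<comment> \<open>A word \<open>b\<close> with incoherent counts cannot be completed by any
    \<open>c\<close> to counts \<open>z\<close>, so its terms vanish.\<close>
  also have "\<dots> = (\<Sum>k\<in>coherent_vectors K n u z. multinom (n-u) (K-1) k * ?F k)"
  proof (rule sum_words_by_letter_counts[OF coherent_vectors_bounded[OF assms(2)]])
    fix b assume b: "b \<in> words D (n-u)" "?lc b \<notin> coherent_vectors K n u z"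
    have "?H (?lc b) (?lc a) = 0" if "a \<in> words D u" for a
    proof -
      have "count_indicator z (mset b + mset c) = 0" if "c \<in> words D (u-1)" for c
      proof -
        have "\<not> (\<forall>p\<in>{1..K-1}. count (mset b + mset c) (d p) = z p)"
          using letter_counts_coherent[OF assms b(1) that, of z] b(2) by blast
        then show ?thesis by (simp only: count_indicator_def if_False)
      qed
      then show ?thesis by (subst inner[OF that b(1), symmetric]) (simp add: sum.neutral)
    qed
    then have "(\<Sum>a\<in>words D u. ?H (?lc b) (?lc a)) = 0" by (rule sum.neutral[rule_format])
    moreover have "(\<Sum>a\<in>words D u. ?H (?lc b) (?lc a)) = ?F (?lc b)"
      by (intro sum_words_by_letter_counts) (auto dest: letter_counts_bounded)
    ultimately show "?F (?lc b) = 0" by (simp only:)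
  qed
  also have "\<dots> = coherent_sum n u z m"
    unfolding coherent_sum_def sum_distrib_left
    by (intro sum.cong refl) (simp add: power_add mult_ac)
  finally show ?thesis .
qed

lemma overlap_cov_expand:
  assumes "1 \<le> u" "u \<le> n"
    and "\<And>A. set_mset A \<subseteq> D \<Longrightarrow> size A = n \<Longrightarrow> \<phi> A = (\<Sum>i\<in>I. a i * f i A)"
    and "\<And>A. set_mset A \<subseteq> D \<Longrightarrow> size A = n - 1 \<Longrightarrow> \<psi> A = (\<Sum>j\<in>J. b j * g j A)"
  shows "overlap_cov n u \<phi> \<psi> = (\<Sum>i\<in>I. \<Sum>j\<in>J. a i * b j * overlap_cov n u (f i) (g j))"
proof -
  let ?W = "words D (n + u - 1)"
  have "overlap_cov n u \<phi> \<psi> = (\<Sum>xs\<in>?W. \<Sum>i\<in>I. \<Sum>j\<in>J.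
      a i * b j * (law xs * (f i (mset (take n xs)) * g j (mset (drop u xs)))))"
    unfolding overlap_cov_def
  proof (intro sum.cong refl)
    fix xs assume xs: "xs \<in> ?W"
    have 1: "\<phi> (mset (take n xs)) = (\<Sum>i\<in>I. a i * f i (mset (take n xs)))"
      using xs assms(1,2) by (intro assms(3)) (auto simp: words_def dest: in_set_takeD)
    have 2: "\<psi> (mset (drop u xs)) = (\<Sum>j\<in>J. b j * g j (mset (drop u xs)))"
      using xs assms(1,2) by (intro assms(4)) (auto simp: words_def dest: in_set_dropD)
    show "law xs * (\<phi> (mset (take n xs)) * \<psi> (mset (drop u xs))) = (\<Sum>i\<in>I. \<Sum>j\<in>J.
        a i * b j * (law xs * (f i (mset (take n xs)) * g j (mset (drop u xs)))))"
      unfolding 1 2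
      by (subst sum_product, subst sum_distrib_left, intro sum.cong refl, subst sum_distrib_left,
          intro sum.cong refl, simp only: mult_ac)
  qed
  also have "\<dots> = (\<Sum>i\<in>I. \<Sum>j\<in>J. \<Sum>xs\<in>?W.
      a i * b j * (law xs * (f i (mset (take n xs)) * g j (mset (drop u xs)))))"
    by (subst sum.swap, intro sum.cong refl, rule sum.swap)
  finally show ?thesis by (simp only: overlap_cov_def sum_distrib_left)
qed

text \<open>Normalized kernels span the degenerate kernels of order \<open>n\<close>, and count
  indicators span all functions \<open>\<psi>\<close> of order \<open>n - 1\<close>; as the
  covariance is bilinear, testing these pairs suffices.\<close>

lemma weakly_independent_iff_coherent_sum:
  "weakly_independent \<longleftrightarrow> (\<forall>n\<ge>2. \<forall>u\<in>{2..n}. \<forall>z\<in>weak_compositions (n-1) K.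
     \<forall>m\<in>bounded_vectors n (K-2). coherent_sum n u z m = 0)"
proof
  assume W: weakly_independent
  show "\<forall>n\<ge>2. \<forall>u\<in>{2..n}. \<forall>z\<in>weak_compositions (n-1) K.
     \<forall>m\<in>bounded_vectors n (K-2). coherent_sum n u z m = 0"
  proof (intro allI impI ballI)
    fix n u :: nat and z m assume "2 \<le> n" and u: "u \<in> {2..n}"
    then have "overlap_cov n u (normalized_kernel m) (count_indicator z) = 0"
      using W normalized_kernel_degenerate[of n m] unfolding weakly_independent_def by simp
    then show "coherent_sum n u z m = 0" using overlap_cov_eq_coherent_sum u by simp
  qed
next
  assume C: "\<forall>n\<ge>2. \<forall>u\<in>{2..n}. \<forall>z\<in>weak_compositions (n-1) K.
     \<forall>m\<in>bounded_vectors n (K-2). coherent_sum n u z m = 0"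
  show weakly_independent
    unfolding weakly_independent_def
  proof (intro allI ballI impI)
    fix n u \<phi> \<psi> assume n: "2 \<le> n" and u: "u \<in> {2..n}" and deg: "degenerate n \<phi>"
    obtain a where a: "\<And>A. set_mset A \<subseteq> D \<Longrightarrow> size A = n \<Longrightarrow>
        \<phi> A = (\<Sum>m\<in>bounded_vectors n (K - 2). a m * normalized_kernel m A)"
      using degenerate_expansion[of n \<phi>] n deg by auto
    obtain b where b: "\<And>A. set_mset A \<subseteq> D \<Longrightarrow> size A = n - 1 \<Longrightarrow>
        \<psi> A = (\<Sum>z\<in>weak_compositions (n-1) K. b z * count_indicator z A)"
      using count_indicator_expansion[of "n - 1" \<psi>] by auto
    have "overlap_cov n u \<phi> \<psi> = (\<Sum>m\<in>bounded_vectors n (K - 2). \<Sum>z\<in>weak_compositions (n-1) K.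
        a m * b z * overlap_cov n u (normalized_kernel m) (count_indicator z))"
      using u by (intro overlap_cov_expand a b) auto
    also have "\<dots> = 0"
    proof (intro sum.neutral ballI)
      fix m z assume "m \<in> bounded_vectors n (K - 2)" "z \<in> weak_compositions (n-1) K"
      then have "overlap_cov n u (normalized_kernel m) (count_indicator z) = 0"
        using overlap_cov_eq_coherent_sum[of u n m z] u C n by simp
      then show "a m * b z * overlap_cov n u (normalized_kernel m) (count_indicator z) = 0" by simp
    qed
    finally show "overlap_cov n u \<phi> \<psi> = 0" .
  qed
qed

end

theorem theorem3p4:
  fixes M :: "'w measure" and D :: "'a set" and d :: "nat \<Rightarrow> 'a"
    and X :: "nat \<Rightarrow> 'w \<Rightarrow> 'a" and K :: nat
  assumes "prob_space M"
    and "K \<ge> 3"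
    and "bij_betw d {1..K} D"
    and "\<And>i. i \<ge> 1 \<Longrightarrow> X i \<in> M \<rightarrow>\<^sub>M count_space D"
    and "exchangeable M (count_space D) X"
    and "\<And>n x. n \<ge> 1 \<Longrightarrow> x \<in> {1..n} \<rightarrow>\<^sub>E D \<Longrightarrow> \<P>(\<omega> in M. \<forall>i\<in>{1..n}. X i \<omega> = x i) > 0"
  shows "hoeffding_decomposable M D X \<longleftrightarrow>
    (\<forall>n\<ge>2. \<forall>u\<in>{2..n}. \<forall>z\<in>weak_compositions (n-1) K.
      \<forall>m\<in>(\<Union>a\<in>{0..n}. weak_compositions a (K-2)).
        (\<Sum>k\<in>coherent_vectors K n u z.
           (-1) ^ k 1 * multinom (n-u) (K-1) k *
           (\<Sum>q\<in>(\<Union>a\<in>{0..u}. weak_compositions a (K-1)).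
              (-1) ^ q 1 * multinom u (K-1) q *
              multinom_star (int (k 1 + q 1)) (K-2)
                (\<lambda>i. int (m i) - int (k (i+1)) - int (q (i+1))) *
              count_cond_prob M K d X n (n+u-1) (\<lambda>p. z p + q p) (\<lambda>p. k p + q p))) = 0)"
proof -
  interpret enumerated_exchangeable M D X d K
    using assms bij_betw_finite[OF assms(3)]
    by (intro enumerated_exchangeable.intro positive_exchangeable.intro
        positive_exchangeable_axioms.intro enumerated_set.intro) simp_all
  show ?thesis
    using hoeffding_decomposable_iff_weakly_independent weakly_independent_iff_coherent_sum
    unfolding coherent_sum_def by (rule trans)
qed

end
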